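(* Let $\mathbf S$ be a surface with a conjugate net. Every plane system of curves on $\mathbf S$ is represented by a differential equation of the type $$dx\,d^2u-du\,d^2x=A\,dx^3+B\,dx^2du+C\,dx\,du^2+D\,du^3$$ (equivalently, $u''=A+Bu'+Cu'^2+Du'^3$ with $u'=du/dx$, $u''=d^2u/dx^2$), where the coefficients $A(x,u),B(x,u),C(x,u),D(x,u)$ are determined by the congruence of planes $\{\omega_P\}$ defining the system, and may coincide with any four arbitrarily given functions by a proper choice of the congruence. Conversely, every equation $u''=A+Bu'+Cu'^2+Du'^3$, whatever the coefficients $A,B,C,D$ may be, determines at each point of the surface a plane, and thus a congruence $\{\omega_P\}$, such that the integral curves of the equation are the curves of the plane system determined by $\{\omega_P\}$.
   Context: Everything is local and complex analytic; the functions $A,B,C,D$ are analytic in $(x,u)$. A surface $\mathbf S\subset\mathbb{C}P_n$ is given by a vector of homogeneous coordinates $y=y(x,u)$. The embedded tangent plane $\Pi_P$ at $P=y$ is the projective plane spanned by $y,y_x,y_u$. $S(2,0)$ at $P$ is the projective span of $y,y_x,y_u,y_{xx},y_{xu},y_{uu}$. The osculating plane of a curve at $P$ is the plane spanned by $y,y',y''$, derivatives being taken along the curve. A surface with a conjugate net is a surface satisfying, in suitable parameters $(x,u)$ (the ones used here), an equation of Laplace $$y_{xu}+ay_x+by_u+cy=0,$$ with $a,b,c$ functions of $(x,u)$, and with $S(2,0)=\mathbb{C}P_4$ (so that $y,y_x,y_u,y_{xx},y_{uu}$ are linearly independent). A congruence of planes $\{\omega_P\}$ is a $2$-parameter family of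 planes, one plane $\omega_P$ attached (analytically) to each point $P\in\mathbf S$, where $\omega_P\subset S(2,0)=\mathbb{C}P_4$ at $P$, $P\in\omega_P$, and $\omega_P$ intersects $\Pi_P$ only at $P$. The plane system determined by $\{\omega_P\}$ is the $2$-parameter system of curves on $\mathbf S$ having the property that at each point $P$ the osculating planes of the curves of the system through $P$ intersect $\omega_P$ in lines. *)

theory Defs
  imports "HOL-Complex_Analysis.Complex_Analysis"
begin

text \<open>
  Points of \<open>CP_n\<close> are given by homogeneous coordinate vectors in \<open>complex ^ 'n\<close>, so that
  \<open>CARD('n) = n + 1\<close>, and projective subspaces by the complex linear subspaces over them.
  Linear notions over the complex numbers carry the prefix \<open>vec\<close>; the unprefixed
  \<open>span\<close> and \<open>dim\<close> are real.
\<close>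

definition proj_subspace :: "nat \<Rightarrow> (complex ^ 'n) set \<Rightarrow> bool" where
  "proj_subspace k L \<longleftrightarrow> vec.subspace L \<and> vec.dim L = k + 1"

text \<open>
  Complex analyticity in two variables, for use on open sets: the total derivative exists and is
  complex linear. As for \<^const>\<open>analytic_on\<close> in one variable, this is equivalent to local
  expansion into convergent power series.
\<close>

definition analytic2_on :: "(complex \<times> complex \<Rightarrow> complex) \<Rightarrow> (complex \<times> complex) set \<Rightarrow> bool"
  (infixl "analytic2'_on" 50) where
  "f analytic2_on U \<longleftrightarrow>
     (\<forall>p\<in>U. \<exists>a b. (f has_derivative (\<lambda>h. a * fst h + b * snd h)) (at p))"

definition vanalytic2_on ::
    "(complex \<times> complex \<Rightarrow> complex ^ 'n) \<Rightarrow> (complex \<times> complex) set \<Rightarrow> bool"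
  (infixl "vanalytic2'_on" 50) where
  "f vanalytic2_on U \<longleftrightarrow> (\<forall>i. (\<lambda>p. f p $ i) analytic2_on U)"

definition vderiv :: "(complex \<Rightarrow> complex ^ 'n) \<Rightarrow> complex \<Rightarrow> complex ^ 'n" where
  "vderiv f t = (\<chi> i. deriv (\<lambda>s. f s $ i) t)"

definition pd_x :: "(complex \<times> complex \<Rightarrow> complex ^ 'n) \<Rightarrow> complex \<times> complex \<Rightarrow> complex ^ 'n" where
  "pd_x y p = vderiv (\<lambda>z. y (z, snd p)) (fst p)"

definition pd_u :: "(complex \<times> complex \<Rightarrow> complex ^ 'n) \<Rightarrow> complex \<times> complex \<Rightarrow> complex ^ 'n" where
  "pd_u y p = vderiv (\<lambda>z. y (fst p, z)) (snd p)"

definition tangent_plane ::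
    "(complex \<times> complex \<Rightarrow> complex ^ 'n) \<Rightarrow> complex \<times> complex \<Rightarrow> (complex ^ 'n) set" where
  "tangent_plane y p = vec.span {y p, pd_x y p, pd_u y p}"

text \<open>The space \<open>S(2,0)\<close> at the point with parameters \<open>p\<close>.\<close>

definition S20 ::
    "(complex \<times> complex \<Rightarrow> complex ^ 'n) \<Rightarrow> complex \<times> complex \<Rightarrow> (complex ^ 'n) set" where
  "S20 y p = vec.span {y p, pd_x y p, pd_u y p,
                       pd_x (pd_x y) p, pd_u (pd_x y) p, pd_u (pd_u y) p}"

definition conjugate_net_surface ::
    "(complex \<times> complex) set \<Rightarrow> (complex \<times> complex \<Rightarrow> complex ^ 'n) \<Rightarrow> bool" where
  "conjugate_net_surface U y \<longleftrightarrow>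
     open U \<and> y vanalytic2_on U \<and>
     (\<exists>a b c. a analytic2_on U \<and> b analytic2_on U \<and> c analytic2_on U \<and>
        (\<forall>p\<in>U. pd_u (pd_x y) p + a p *s pd_x y p + b p *s pd_u y p + c p *s y p = 0)) \<and>
     (\<forall>p\<in>U. proj_subspace 4 (S20 y p))"

text \<open>
  Points of the surface are indexed by their parameters. That the planes are attached analytically
  means that they are locally spanned by analytic vector functions.
\<close>

definition plane_congruence ::
    "(complex \<times> complex) set \<Rightarrow> (complex \<times> complex \<Rightarrow> complex ^ 'n) \<Rightarrow>
     (complex \<times> complex \<Rightarrow> (complex ^ 'n) set) \<Rightarrow> bool" where
  "plane_congruence U y \<omega> \<longleftrightarrow>
     (\<forall>p\<in>U. proj_subspace 2 (\<omega> p) \<and> \<omega> p \<subseteq> S20 y p \<and> y p \<in> \<omega> p \<and>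
            \<omega> p \<inter> tangent_plane y p = vec.span {y p}) \<and>
     (\<forall>p\<in>U. \<exists>V w1 w2 w3. open V \<and> p \<in> V \<and> V \<subseteq> U \<and>
            w1 vanalytic2_on V \<and> w2 vanalytic2_on V \<and> w3 vanalytic2_on V \<and>
            (\<forall>q\<in>V. \<omega> q = vec.span {w1 q, w2 q, w3 q}))"

text \<open>
  A curve on the surface is given by regular analytic functions \<open>x = \<xi> t\<close>, \<open>u = \<eta> t\<close> of a
  complex parameter. Regularity is what makes the osculating plane a plane.
\<close>

definition surface_curve ::
    "(complex \<times> complex) set \<Rightarrow> complex set \<Rightarrow> (complex \<Rightarrow> complex) \<Rightarrow> (complex \<Rightarrow> complex) \<Rightarrow> bool"
  where
  "surface_curve U T \<xi> \<eta> \<longleftrightarrow>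
     open T \<and> connected T \<and> T \<noteq> {} \<and> \<xi> holomorphic_on T \<and> \<eta> holomorphic_on T \<and>
     (\<forall>t\<in>T. (\<xi> t, \<eta> t) \<in> U \<and> (deriv \<xi> t, deriv \<eta> t) \<noteq> (0, 0))"

definition osculating_plane :: "(complex \<Rightarrow> complex ^ 'n) \<Rightarrow> complex \<Rightarrow> (complex ^ 'n) set" where
  "osculating_plane g t = vec.span {g t, vderiv g t, vderiv (vderiv g) t}"

definition plane_system ::
    "(complex \<times> complex) set \<Rightarrow> (complex \<times> complex \<Rightarrow> complex ^ 'n) \<Rightarrow>
     (complex \<times> complex \<Rightarrow> (complex ^ 'n) set) \<Rightarrow>
     (complex set \<times> (complex \<Rightarrow> complex) \<times> (complex \<Rightarrow> complex)) set" where
  "plane_system U y \<omega> = {(T, \<xi>, \<eta>). surface_curve U T \<xi> \<eta> \<and>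
     (\<forall>t\<in>T. proj_subspace 1
        (osculating_plane (\<lambda>s. y (\<xi> s, \<eta> s)) t \<inter> \<omega> (\<xi> t, \<eta> t)))}"

text \<open>The curves with \<open>dx d\<^sup>2u - du d\<^sup>2x = A dx\<^sup>3 + B dx\<^sup>2 du + C dx du\<^sup>2 + D du\<^sup>3\<close>.\<close>

definition integral_curves ::
    "(complex \<times> complex) set \<Rightarrow>
     (complex \<times> complex \<Rightarrow> complex) \<Rightarrow> (complex \<times> complex \<Rightarrow> complex) \<Rightarrow>
     (complex \<times> complex \<Rightarrow> complex) \<Rightarrow> (complex \<times> complex \<Rightarrow> complex) \<Rightarrow>
     (complex set \<times> (complex \<Rightarrow> complex) \<times> (complex \<Rightarrow> complex)) set" where
  "integral_curves U A B C D = {(T, \<xi>, \<eta>). surface_curve U T \<xi> \<eta> \<and>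
     (\<forall>t\<in>T. deriv \<xi> t * deriv (deriv \<eta>) t - deriv \<eta> t * deriv (deriv \<xi>) t =
        A (\<xi> t, \<eta> t) * deriv \<xi> t ^ 3 + B (\<xi> t, \<eta> t) * deriv \<xi> t ^ 2 * deriv \<eta> t +
        C (\<xi> t, \<eta> t) * deriv \<xi> t * deriv \<eta> t ^ 2 + D (\<xi> t, \<eta> t) * deriv \<eta> t ^ 3)}"

definition analytic_coeffs ::
    "(complex \<times> complex) set \<Rightarrow>
     (complex \<times> complex \<Rightarrow> complex) \<Rightarrow> (complex \<times> complex \<Rightarrow> complex) \<Rightarrow>
     (complex \<times> complex \<Rightarrow> complex) \<Rightarrow> (complex \<times> complex \<Rightarrow> complex) \<Rightarrow> bool" where
  "analytic_coeffs U A B C D \<longleftrightarrow>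
     A analytic2_on U \<and> B analytic2_on U \<and> C analytic2_on U \<and> D analytic2_on U"

end

theory Submission
  imports Defs
begin

text \<open>
  By the equation of Laplace, \<open>y, y\<^sub>x, y\<^sub>u, y\<^sub>x\<^sub>x, y\<^sub>u\<^sub>u\<close> is a frame of \<open>S(2,0)\<close>. A plane that
  meets the tangent plane only at \<open>y\<close> is spanned by \<open>y\<close>, \<open>y\<^sub>x\<^sub>x + \<alpha> y\<^sub>x + \<beta> y\<^sub>u\<close> and
  \<open>y\<^sub>u\<^sub>u + \<gamma> y\<^sub>x + \<delta> y\<^sub>u\<close> for unique \<open>\<alpha>, \<beta>, \<gamma>, \<delta>\<close>. Expanding the second derivative along
  a curve in this frame, the osculating plane meets the plane in a line iff a \<open>2 \<times> 2\<close> determinant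
  vanishes, and this is the differential equation with \<open>A = \<beta>\<close>, \<open>B = 2b - \<alpha>\<close>, \<open>C = \<delta> - 2a\<close>,
  \<open>D = -\<gamma>\<close>. Hence congruences and quadruples of coefficients correspond bijectively; that the
  curves in turn determine the coefficients uses the existence of an integral curve through each
  point in the directions \<open>u' = v\<close>, obtained by Picard iteration.
\<close>

unbundle no fps_syntax

section \<open>Analytic functions of two variables\<close>


text \<open>Analyticity here is only first-order complex differentiability, so analyticity and
  symmetry of higher partial derivatives must be proved: Cauchy's formula in one variable is
  differentiated under the integral in the other. The determinant arises modulo the plane. There
  \<open>y\<^sub>x\<^sub>x\<close> and \<open>y\<^sub>u\<^sub>u\<close> become combinations of
  \<open>y\<^sub>x\<close> and \<open>y\<^sub>u\<close>, so the first two derivatives along a curve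
  are vectors in a two-dimensional quotient; apart from the accelerations, one is linear and the
  other quadratic in the velocity, whence a cubic. The mixed derivative, rewritten by Laplace's
  equation, shifts its middle coefficients by \<open>2b\<close> and \<open>-2a\<close>. A congruence
  comes with unspecified local spanning vectors, so analyticity of \<alpha>, \<beta>, \<gamma>,
  \<delta> has to be recovered from their being coordinates in an analytic frame. Existence matters
  because equal sets of curves say nothing at a point that no curve crosses. Once every slope
  \<open>v\<close> occurs at the point, two equations with the same curves differ there by a cubic
  in \<open>v\<close> that vanishes identically.\<close>

definition px :: "(complex \<times> complex \<Rightarrow> complex) \<Rightarrow> complex \<times> complex \<Rightarrow> complex" where
  "px f p = deriv (\<lambda>z. f (z, snd p)) (fst p)"

definition pu :: "(complex \<times> complex \<Rightarrow> complex) \<Rightarrow> complex \<times> complex \<Rightarrow> complex" where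
  "pu f p = deriv (\<lambda>z. f (fst p, z)) (snd p)"

lemma analytic2_onI:
  assumes "\<And>p. p \<in> U \<Longrightarrow> (f has_derivative (\<lambda>h. a p * fst h + b p * snd h)) (at p)"
  shows "f analytic2_on U"
  using assms unfolding analytic2_on_def by blast

lemma analytic2_on_subset: "f analytic2_on U \<Longrightarrow> V \<subseteq> U \<Longrightarrow> f analytic2_on V"
  unfolding analytic2_on_def by blast

text \<open>The definition is pointwise, so \<open>analytic2_on {p}\<close> means differentiability
  at \<open>p\<close> itself; local arguments can be run there and reassembled.\<close>

lemma analytic2_on_pointwise: "f analytic2_on U \<longleftrightarrow> (\<forall>p\<in>U. f analytic2_on {p})"
  unfolding analytic2_on_def by blast

lemma analytic2_on_const: "(\<lambda>p. c) analytic2_on U"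
  by (rule analytic2_onI[where a="\<lambda>_. 0" and b="\<lambda>_. 0"]) simp

lemma analytic2_on_add:
  assumes "f analytic2_on U" "g analytic2_on U"
  shows "(\<lambda>p. f p + g p) analytic2_on U"
  unfolding analytic2_on_def
proof
  fix p assume "p \<in> U"
  with assms obtain a b c d where "(f has_derivative (\<lambda>h. a * fst h + b * snd h)) (at p)"
    "(g has_derivative (\<lambda>h. c * fst h + d * snd h)) (at p)"
    unfolding analytic2_on_def by meson
  from has_derivative_add[OF this]
  have "((\<lambda>p. f p + g p) has_derivative (\<lambda>h. (a + c) * fst h + (b + d) * snd h)) (at p)"
    by (rule has_derivative_eq_rhs) (auto simp: algebra_simps)
  then show "\<exists>a b. ((\<lambda>p. f p + g p) has_derivative (\<lambda>h. a * fst h + b * snd h)) (at p)"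
    by blast
qed

lemma analytic2_on_mult:
  assumes "f analytic2_on U" "g analytic2_on U"
  shows "(\<lambda>p. f p * g p) analytic2_on U"
  unfolding analytic2_on_def
proof
  fix p assume "p \<in> U"
  with assms obtain a b c d where "(f has_derivative (\<lambda>h. a * fst h + b * snd h)) (at p)"
    "(g has_derivative (\<lambda>h. c * fst h + d * snd h)) (at p)"
    unfolding analytic2_on_def by meson
  from has_derivative_mult[OF this]
  have "((\<lambda>p. f p * g p) has_derivative
      (\<lambda>h. (f p * c + a * g p) * fst h + (f p * d + b * g p) * snd h)) (at p)"
    by (rule has_derivative_eq_rhs) (auto simp: algebra_simps)
  then show "\<exists>a b. ((\<lambda>p. f p * g p) has_derivative (\<lambda>h. a * fst h + b * snd h)) (at p)"
    by blast
qed

lemma analytic2_on_inverse: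
  assumes "f analytic2_on U" "\<And>p. p \<in> U \<Longrightarrow> f p \<noteq> 0"
  shows "(\<lambda>p. inverse (f p)) analytic2_on U"
  unfolding analytic2_on_def
proof
  fix p assume p: "p \<in> U"
  with assms obtain a b where *: "(f has_derivative (\<lambda>h. a * fst h + b * snd h)) (at p)"
    unfolding analytic2_on_def by meson
  have "((\<lambda>p. inverse (f p)) has_derivative
      (\<lambda>h. (- a / f p ^ 2) * fst h + (- b / f p ^ 2) * snd h)) (at p)"
    by (rule has_derivative_eq_rhs[OF Deriv.has_derivative_inverse[OF assms(2)[OF p] *]])
      (auto simp: field_simps power2_eq_square assms(2)[OF p])
  then show "\<exists>a b. ((\<lambda>p. inverse (f p)) has_derivative (\<lambda>h. a * fst h + b * snd h)) (at p)"
    by blast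
qed

lemma analytic2_on_uminus: "f analytic2_on U \<Longrightarrow> (\<lambda>p. - f p) analytic2_on U"
  using analytic2_on_mult[OF analytic2_on_const[of "-1"]] by simp

lemma analytic2_on_diff:
  "f analytic2_on U \<Longrightarrow> g analytic2_on U \<Longrightarrow> (\<lambda>p. f p - g p) analytic2_on U"
  using analytic2_on_add[OF _ analytic2_on_uminus] by simp

lemma analytic2_on_sum:
  "(\<And>i. i \<in> I \<Longrightarrow> f i analytic2_on U) \<Longrightarrow> (\<lambda>p. \<Sum>i\<in>I. f i p) analytic2_on U"
  by (induction I rule: infinite_finite_induct) (auto intro: analytic2_on_const analytic2_on_add)

lemma analytic2_on_prod:
  "(\<And>i. i \<in> I \<Longrightarrow> f i analytic2_on U) \<Longrightarrow> (\<lambda>p. \<Prod>i\<in>I. f i p) analytic2_on U"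
  by (induction I rule: infinite_finite_induct) (auto intro: analytic2_on_const analytic2_on_mult)

lemmas analytic2_intros = analytic2_on_const analytic2_on_add analytic2_on_diff analytic2_on_mult
  analytic2_on_uminus analytic2_on_sum analytic2_on_prod analytic2_on_inverse

lemma analytic2_on_cong_at:
  assumes "f analytic2_on {p}" "\<forall>\<^sub>F q in nhds p. f q = g q"
  shows "g analytic2_on {p}"
  using assms has_derivative_transform_eventually[of f _ p UNIV g]
  unfolding analytic2_on_def eventually_nhds_conv_at by auto

lemma analytic2_on_imp_continuous_on: "f analytic2_on U \<Longrightarrow> continuous_on U f"
  unfolding analytic2_on_def
  by (meson continuous_at_imp_continuous_on has_derivative_continuous)

lemma has_derivative_along:
  assumes "(f has_derivative (\<lambda>h. a * fst h + b * snd h)) (at (\<xi> t, \<eta> t))"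
    and "(\<xi> has_field_derivative \<xi>') (at t)" "(\<eta> has_field_derivative \<eta>') (at t)"
  shows "((\<lambda>s. f (\<xi> s, \<eta> s)) has_field_derivative a * \<xi>' + b * \<eta>') (at t)"
proof -
  have "((\<lambda>s. (\<xi> s, \<eta> s)) has_derivative (\<lambda>h. (\<xi>' * h, \<eta>' * h))) (at t)"
    using assms(2,3) unfolding has_field_derivative_def by (rule has_derivative_Pair)
  from has_derivative_compose[OF this, of f, OF assms(1)]
  show ?thesis unfolding has_field_derivative_def
    by (rule has_derivative_eq_rhs) (auto simp: algebra_simps)
qed

lemma has_derivative_imp_partials:
  assumes "(f has_derivative (\<lambda>h. a * fst h + b * snd h)) (at (x, u))"
  shows "((\<lambda>z. f (z, u)) has_field_derivative a) (at x)"
    and "((\<lambda>z. f (x, z)) has_field_derivative b) (at u)"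
  using has_derivative_along[where \<xi>="\<lambda>z. z" and \<eta>="\<lambda>z. u"
    and t=x, OF assms DERIV_ident DERIV_const]
    has_derivative_along[where \<xi>="\<lambda>z. x" and \<eta>="\<lambda>z. z" and t=u, OF assms DERIV_const DERIV_ident]
  by simp_all

lemma analytic2_on_has_derivative:
  assumes "f analytic2_on U" "p \<in> U"
  shows "(f has_derivative (\<lambda>h. px f p * fst h + pu f p * snd h)) (at p)"
proof -
  obtain a b where *: "(f has_derivative (\<lambda>h. a * fst h + b * snd h)) (at p)"
    using assms unfolding analytic2_on_def by blast
  then have "px f p = a" "pu f p = b"
    using has_derivative_imp_partials[of f a b "fst p" "snd p"]
    by (auto simp: px_def pu_def intro: DERIV_imp_deriv)
  with * show ?thesis by simp
qed

lemma analytic2_on_DERIV: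
  assumes "f analytic2_on U" "(x, u) \<in> U"
  shows "((\<lambda>z. f (z, u)) has_field_derivative px f (x, u)) (at x)"
  and "((\<lambda>z. f (x, z)) has_field_derivative pu f (x, u)) (at u)"
  using has_derivative_imp_partials[OF analytic2_on_has_derivative[OF assms]] by auto

lemma analytic2_on_chain:
  assumes "f analytic2_on U" "(\<xi> t, \<eta> t) \<in> U"
    and "(\<xi> has_field_derivative \<xi>') (at t)" "(\<eta> has_field_derivative \<eta>') (at t)"
  shows "((\<lambda>s. f (\<xi> s, \<eta> s)) has_field_derivative
           px f (\<xi> t, \<eta> t) * \<xi>' + pu f (\<xi> t, \<eta> t) * \<eta>') (at t)"
  by (rule has_derivative_along[OF analytic2_on_has_derivative[OF assms(1,2)] assms(3,4)])

section \<open>Cauchy's formula and regularity of the partial derivatives\<close>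

lemma open_polydisc:
  assumes "open U" "(x, u) \<in> U"
  obtains r where "r > 0" "cball x r \<times> cball u r \<subseteq> (U :: (complex \<times> complex) set)"
proof -
  obtain A B where "open A" "open B" "x \<in> A" "u \<in> B" "A \<times> B \<subseteq> U"
    using open_prod_elim[OF assms] by (metis mem_Sigma_iff)
  moreover then obtain r s where "r > 0" "cball x r \<subseteq> A" "s > 0" "cball u s \<subseteq> B"
    by (meson open_contains_cball)
  ultimately have "cball x (min r s) \<times> cball u (min r s) \<subseteq> U" "min r s > 0" by fastforce+
  then show ?thesis using that by blast
qed

text \<open>The parametrisation of \<open>circlepath\<close>, spelled out so that contour integrals
  become integrals over \<open>cbox 0 1\<close>, the form in which parameter integrals can be shown
  continuous and differentiable.\<close>

definition circ :: "complex \<Rightarrow> real \<Rightarrow> real \<Rightarrow> complex" where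
  "circ x r t = x + of_real r * exp (2 * of_real pi * \<i> * of_real t)"

text \<open>
  The velocity of \<^const>\<open>circ\<close> without the factor \<open>2 \<pi> \<i>\<close>, which cancels against the one in
  Cauchy's formula.
\<close>

definition circ' :: "complex \<Rightarrow> real \<Rightarrow> real \<Rightarrow> complex" where
  "circ' x r t = of_real r * exp (2 * of_real pi * \<i> * of_real t)"

lemma circ_in: "r > 0 \<Longrightarrow> circ x r t \<in> sphere x r"
  by (simp add: circ_def dist_norm norm_mult)

text \<open>Cauchy's formula for the first derivative. A derivative becomes an integral of values on
  a circle, so regularity in a second variable can pass under the integral.\<close>

lemma deriv_eq_integral_circ:
  assumes "continuous_on (cball x0 r) g" "g holomorphic_on ball x0 r" "x \<in> ball x0 r"
  shows "deriv g x =
    integral (cbox 0 1) (\<lambda>t. g (circ x0 r t) / (circ x0 r t - x) ^ 2 * circ' x0 r t)"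
proof -
  have "2 * of_real pi * \<i> * deriv g x
      = contour_integral (circlepath x0 r) (\<lambda>u. g u / (u - x)\<^sup>2)"
    using Cauchy_contour_integral_circlepath_2[OF assms] by simp
  also have "\<dots> = integral {0..1}
      (\<lambda>t. 2 * of_real pi * \<i> * (g (circ x0 r t) / (circ x0 r t - x) ^ 2 * circ' x0 r t))"
    unfolding contour_integral_integral vector_derivative_circlepath
    by (simp add: circ_def circ'_def circlepath algebra_simps)
  also have "\<dots> = 2 * of_real pi * \<i> *
      integral {0..1} (\<lambda>t. g (circ x0 r t) / (circ x0 r t - x) ^ 2 * circ' x0 r t)"
    by (rule integral_mult_right)
  finally show ?thesis by simp
qed

lemma continuous_on_circ [continuous_intros]:
  "continuous_on S f \<Longrightarrow> continuous_on S (\<lambda>p. circ x0 r (f p))"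
  "continuous_on S f \<Longrightarrow> continuous_on S (\<lambda>p. circ' x0 r (f p))"
  unfolding circ_def circ'_def by (auto intro!: continuous_intros)

text \<open>The points of the open disc never reach the circle, so the denominator does not
  vanish.\<close>

lemma continuous_on_cauchy_kernel:
  assumes "continuous_on (cball x0 r \<times> cball u0 r) f" "r > 0"
  shows "continuous_on ((ball x0 r \<times> ball u0 r) \<times> cbox 0 1)
    (\<lambda>(p, t). f (circ x0 r t, snd p) / (circ x0 r t - fst p) ^ 2 * circ' x0 r t)"
proof -
  have "circ x0 r t \<noteq> x" if "x \<in> ball x0 r" for t x
    using circ_in[OF assms(2), of x0 t] that by auto
  moreover have "continuous_on ((ball x0 r \<times> ball u0 r) \<times> cbox 0 1)
      (\<lambda>q. f (circ x0 r (snd q), snd (fst q)))"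
    using circ_in[OF assms(2), of x0]
    by (intro continuous_on_compose2[OF assms(1)] continuous_intros) (auto simp: less_imp_le)
  ultimately show ?thesis
    by (auto simp: split_beta intro!: continuous_intros)
qed

lemma px_eq_integral:
  assumes cont: "continuous_on U f" and sub: "cball x0 r \<times> cball u0 r \<subseteq> U" and r: "r > 0"
    and hol: "\<And>x u. (x, u) \<in> U \<Longrightarrow> (\<lambda>z. f (z, u)) field_differentiable at x"
    and p: "p \<in> ball x0 r \<times> ball u0 r"
  shows "px f p = integral (cbox 0 1)
    (\<lambda>t. f (circ x0 r t, snd p) / (circ x0 r t - fst p) ^ 2 * circ' x0 r t)"
  unfolding px_def
proof (rule deriv_eq_integral_circ)
  have u: "snd p \<in> cball u0 r" using p by auto
  show "continuous_on (cball x0 r) (\<lambda>z. f (z, snd p))"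
    by (intro continuous_on_compose2[OF cont] continuous_intros) (use u sub in auto)
  show "(\<lambda>z. f (z, snd p)) holomorphic_on ball x0 r"
    unfolding holomorphic_on_def
  proof
    fix x assume "x \<in> ball x0 r"
    then have "(x, snd p) \<in> U" using u sub by auto
    then show "(\<lambda>z. f (z, snd p)) field_differentiable at x within ball x0 r"
      by (rule field_differentiable_at_within[OF hol])
  qed
qed (use p in auto)

text \<open>Near each point \<open>px f\<close> is a Cauchy integral whose integrand is jointly
  continuous in the point and the parameter.\<close>

lemma continuous_on_px:
  assumes U: "open U" and cont: "continuous_on U f"
    and hol: "\<And>x u. (x, u) \<in> U \<Longrightarrow> (\<lambda>z. f (z, u)) field_differentiable at x"
  shows "continuous_on U (px f)"
proof (rule continuous_at_imp_continuous_on, rule ballI)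
  fix p assume "p \<in> U"
  then obtain r where r: "r > 0" "cball (fst p) r \<times> cball (snd p) r \<subseteq> U"
    using open_polydisc[OF U, of "fst p" "snd p"] by auto
  let ?B = "ball (fst p) r \<times> ball (snd p) r"
  have c: "continuous_on (cball (fst p) r \<times> cball (snd p) r) f"
    using cont r(2) continuous_on_subset by blast
  have "continuous_on ?B (px f)"
    using integral_continuous_on_param[OF continuous_on_cauchy_kernel[OF c r(1)]]
    by (rule continuous_on_eq) (use px_eq_integral[OF cont r(2) r(1) hol] in auto)
  moreover have "open ?B" "p \<in> ?B" using r by (auto simp: open_Times mem_Times_iff)
  ultimately show "isCont (px f) p" using continuous_on_eq_continuous_at by blast
qed

text \<open>Exchanging the variables reduces statements about \<open>pu\<close> to those about
  \<open>px\<close>.\<close>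

definition swap2 :: "(complex \<times> complex \<Rightarrow> complex) \<Rightarrow> complex \<times> complex \<Rightarrow> complex" where
  "swap2 f p = f (prod.swap p)"

lemma pu_eq_px: "pu f p = px (swap2 f) (prod.swap p)"
  by (simp add: pu_def px_def swap2_def)

lemma continuous_on_swap2: "continuous_on U f \<Longrightarrow> continuous_on (prod.swap ` U) (swap2 f)"
  unfolding swap2_def by (rule continuous_on_compose2[where f=prod.swap])
    (auto intro: continuous_intros)

lemma open_swap: "open U \<Longrightarrow> open (prod.swap ` (U :: (complex \<times> complex) set))"
proof -
  have "prod.swap ` U = prod.swap -` U" by force
  then show "open U \<Longrightarrow> open (prod.swap ` U)" by (simp add: open_vimage continuous_on_swap)
qed

lemma continuous_on_pu:
  assumes U: "open U" and cont: "continuous_on U f"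
    and hol: "\<And>x u. (x, u) \<in> U \<Longrightarrow> (\<lambda>z. f (x, z)) field_differentiable at u"
  shows "continuous_on U (pu f)"
proof -
  have "continuous_on (prod.swap ` U) (px (swap2 f))"
    using open_swap[OF U] continuous_on_swap2[OF cont]
    by (rule continuous_on_px) (use hol in \<open>auto simp: swap2_def\<close>)
  from continuous_on_compose2[OF this, of U prod.swap] show ?thesis
    by (simp add: pu_eq_px[abs_def] continuous_on_swap)
qed

text \<open>Osgood's lemma. Joint continuity makes \<open>pu f\<close> continuous, and one
  continuous partial derivative together with existence of the other gives the total
  derivative.\<close>

lemma separately_holomorphic_imp_analytic2_on:
  assumes U: "open U" and cont: "continuous_on U f"
    and hx: "\<And>x u. (x, u) \<in> U \<Longrightarrow> (\<lambda>z. f (z, u)) field_differentiable at x"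
    and hu: "\<And>x u. (x, u) \<in> U \<Longrightarrow> (\<lambda>z. f (x, z)) field_differentiable at u"
  shows "f analytic2_on U"
proof (rule analytic2_onI)
  fix p assume p: "p \<in> U"
  obtain x u where [simp]: "p = (x, u)" by (cases p)
  obtain r where r: "r > 0" "cball x r \<times> cball u r \<subseteq> U"
    using open_polydisc[OF U, of x u] p by auto
  let ?X = "ball x r" and ?Y = "ball u r"
  have sub: "?X \<times> ?Y \<subseteq> U" using r(2) by auto
  have *: "((\<lambda>(x, y). f (x, y)) has_derivative
    (\<lambda>(tx, ty). (*) (px f p) tx + blinfun_mult_right (pu f (x, u)) ty)) (at (x, u) within ?X \<times> ?Y)"
  proof (rule has_derivative_partialsI)
    show "((\<lambda>x. f (x, u)) has_derivative (*) (px f p)) (at x within ?X)"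
      using hx[of x u] p unfolding px_def
      by (auto simp: DERIV_deriv_iff_field_differentiable has_field_derivative_at_within
          simp flip: has_field_derivative_def)
    show "((\<lambda>y. f (x', y)) has_derivative blinfun_apply (blinfun_mult_right (pu f (x', u'))))
        (at u' within ?Y)"
      if "x' \<in> ?X" "u' \<in> ?Y" for x' u'
    proof -
      have "(x', u') \<in> U" using that sub by auto
      from hu[OF this] show ?thesis unfolding pu_def
        by (auto simp: DERIV_deriv_iff_field_differentiable has_field_derivative_at_within
            simp flip: has_field_derivative_def)
    qed
    have "continuous_on (?X \<times> ?Y) (pu f)"
      using continuous_on_pu[OF U cont hu] sub continuous_on_subset by blast
    then have "continuous_on (?X \<times> ?Y) (\<lambda>(x, y). blinfun_mult_right (pu f (x, y)))"
      by (auto simp: split_beta intro!: continuous_intros)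
    then show "continuous (at (x, u) within ?X \<times> ?Y) (\<lambda>(x, y). blinfun_mult_right (pu f (x, y)))"
      using r(1) unfolding continuous_on_eq_continuous_within by (meson SigmaI centre_in_ball)
  qed (use r in auto)
  moreover have "at (x, u) within ?X \<times> ?Y = at (x, u)"
    by (rule at_within_open) (use r in \<open>auto simp: open_Times\<close>)
  ultimately show "(f has_derivative (\<lambda>h. px f p * fst h + pu f p * snd h)) (at p)"
    by (simp add: case_prod_unfold)
qed

text \<open>Leibniz's rule applied to Cauchy's integral for \<open>px f\<close>. The resulting
  integral is also Cauchy's integral for \<open>px (pu f)\<close>, which later gives the symmetry of
  mixed derivatives.\<close>

lemma px_has_derivative_u:
  assumes U: "open U" and f: "f analytic2_on U" and sub: "cball x0 r \<times> cball u0 r \<subseteq> U"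
    and r: "r > 0"
    and p: "x \<in> ball x0 r" "u \<in> ball u0 r"
  shows "((\<lambda>z. px f (x, z)) has_field_derivative integral (cbox 0 1)
    (\<lambda>t. pu f (circ x0 r t, u) / (circ x0 r t - x) ^ 2 * circ' x0 r t)) (at u)"
proof -
  have fx: "(\<lambda>z. f (z, u)) field_differentiable at x" if "(x, u) \<in> U" for x u
    using analytic2_on_DERIV(1)[OF f that] field_differentiable_def by blast
  have fu: "(\<lambda>z. f (x, z)) field_differentiable at u" if "(x, u) \<in> U" for x u
    using analytic2_on_DERIV(2)[OF f that] field_differentiable_def by blast
  note cont = analytic2_on_imp_continuous_on[OF f]
  have c: "continuous_on (cball x0 r \<times> cball u0 r) f"
    "continuous_on (cball x0 r \<times> cball u0 r) (pu f)"
    using cont continuous_on_pu[OF U cont fu] sub continuous_on_subset by blast+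
  note k = continuous_on_cauchy_kernel[OF _ r, of x0 u0]
  have in_U: "(circ x0 r t, z) \<in> U" if "z \<in> ball u0 r" for t z
    using circ_in[OF r, of x0 t] that sub by (auto simp: subset_iff)
  have ne: "circ x0 r t \<noteq> x" for t using circ_in[OF r, of x0 t] p(1) by auto
  \<comment> \<open>The kernel with \<open>x\<close> frozen, since Leibniz's rule varies only the
    second coordinate.\<close>
  have sl: "continuous_on (ball u0 r \<times> cbox 0 1)
      (\<lambda>(z, t). g (circ x0 r t, z) / (circ x0 r t - x) ^ 2 * circ' x0 r t)"
    if "continuous_on (cball x0 r \<times> cball u0 r) g" for g
  proof -
    have "continuous_on (ball u0 r \<times> cbox 0 1) (\<lambda>q :: complex \<times> real. ((x, fst q), snd q))"
      by (intro continuous_intros)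
    moreover have "(\<lambda>q :: complex \<times> real. ((x, fst q), snd q)) ` (ball u0 r \<times> cbox 0 1)
        \<subseteq> (ball x0 r \<times> ball u0 r) \<times> cbox 0 1" using p(1) by auto
    ultimately show ?thesis
      using continuous_on_compose2[OF k[OF that], of "ball u0 r \<times> cbox 0 1"
        "\<lambda>q. ((x, fst q), snd q)"]
      by (simp add: split_beta)
  qed
  have "((\<lambda>z. integral (cbox 0 1) (\<lambda>t. f (circ x0 r t, z) / (circ x0 r t - x) ^ 2 * circ' x0 r t))
    has_field_derivative integral (cbox 0 1)
      (\<lambda>t. pu f (circ x0 r t, u) / (circ x0 r t - x) ^ 2 * circ' x0 r t)) (at u within ball u0 r)"
  proof (rule leibniz_rule_field_derivative[OF _ _ sl[OF c(2)]])
    show "((\<lambda>z. f (circ x0 r t, z) / (circ x0 r t - x) ^ 2 * circ' x0 r t) has_field_derivative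
      pu f (circ x0 r t, z) / (circ x0 r t - x) ^ 2 * circ' x0 r t) (at z within ball u0 r)"
      if "z \<in> ball u0 r" for z t
      using ne[of t]
      by (intro DERIV_cmult_right DERIV_cdivide
          DERIV_subset[OF analytic2_on_DERIV(2)[OF f in_U[OF that]]]) simp
    show "(\<lambda>t. f (circ x0 r t, z) / (circ x0 r t - x) ^ 2 * circ' x0 r t) integrable_on cbox 0 1"
      if z: "z \<in> ball u0 r" for z
    proof (rule integrable_continuous)
      have "continuous_on (cbox 0 1) (\<lambda>t :: real. (z, t))" by (intro continuous_intros)
      moreover have "Pair z ` cbox (0 :: real) 1 \<subseteq> ball u0 r \<times> cbox 0 1" using z by auto
      ultimately show "continuous_on (cbox 0 1)
          (\<lambda>t. f (circ x0 r t, z) / (circ x0 r t - x) ^ 2 * circ' x0 r t)"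
        using continuous_on_compose2[OF sl[OF c(1)], of "cbox 0 1" "Pair z"] by simp
    qed
  qed (use p in auto)
  then have "((\<lambda>z. px f (x, z)) has_field_derivative integral (cbox 0 1)
      (\<lambda>t. pu f (circ x0 r t, u) / (circ x0 r t - x) ^ 2 * circ' x0 r t)) (at u within ball u0 r)"
    by (rule has_field_derivative_transform_within[where d=1])
      (use px_eq_integral[OF cont sub r fx] p in auto)
  then show ?thesis using at_within_open[OF p(2)] by simp
qed

text \<open>By Osgood's lemma it is enough to treat the variables separately: in \<open>x\<close>
  this is the derivative of a holomorphic function, in \<open>u\<close> it is Leibniz's
  rule.\<close>

lemma analytic2_on_px:
  assumes U: "open U" and f: "f analytic2_on U"
  shows "px f analytic2_on U"
proof (rule separately_holomorphic_imp_analytic2_on[OF U])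
  have fx: "(\<lambda>z. f (z, u)) field_differentiable at x" if "(x, u) \<in> U" for x u
    using analytic2_on_DERIV(1)[OF f that] field_differentiable_def by blast
  show "continuous_on U (px f)"
    by (rule continuous_on_px[OF U analytic2_on_imp_continuous_on[OF f] fx])
  fix x u assume xu: "(x, u) \<in> U"
  then obtain r where r: "r > 0" "cball x r \<times> cball u r \<subseteq> U" using open_polydisc[OF U] by blast
  show "(\<lambda>z. px f (x, z)) field_differentiable at u"
    using px_has_derivative_u[OF U f r(2,1), of x u] r(1) by (auto simp: field_differentiable_def)
  have "(\<lambda>z. f (z, u)) holomorphic_on ball x r"
    unfolding holomorphic_on_def
  proof
    fix x' assume "x' \<in> ball x r"
    then have "(x', u) \<in> U" using r by auto
    then show "(\<lambda>z. f (z, u)) field_differentiable at x' within ball x r"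
      by (rule field_differentiable_at_within[OF fx])
  qed
  from holomorphic_deriv[OF this] show "(\<lambda>z. px f (z, u)) field_differentiable at x"
    using r(1) by (auto simp: px_def holomorphic_on_open field_differentiable_def)
qed

lemma analytic2_on_swap2:
  assumes "f analytic2_on U" shows "swap2 f analytic2_on (prod.swap ` U)"
  unfolding analytic2_on_def
proof
  fix p assume "p \<in> prod.swap ` U"
  then obtain a b where "(f has_derivative (\<lambda>h. a * fst h + b * snd h)) (at (prod.swap p))"
    using assms unfolding analytic2_on_def by fastforce
  moreover have "(prod.swap has_derivative prod.swap) (at p)"
    by (simp add: prod.swap_def[abs_def]) (auto intro!: derivative_eq_intros)
  ultimately have "(swap2 f has_derivative (\<lambda>h. a * snd h + b * fst h)) (at p)"
    using has_derivative_compose[of prod.swap prod.swap p UNIV f "\<lambda>h. a * fst h + b * snd h"]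
    by (simp add: swap2_def[abs_def])
  then show "\<exists>a b. (swap2 f has_derivative (\<lambda>h. a * fst h + b * snd h)) (at p)"
    by (subst (asm) add.commute) blast
qed

lemma analytic2_on_pu:
  assumes U: "open U" and f: "f analytic2_on U"
  shows "pu f analytic2_on U"
proof -
  have "swap2 (px (swap2 f)) analytic2_on (prod.swap ` prod.swap ` U)"
    by (intro analytic2_on_swap2 analytic2_on_px open_swap assms)
  then show ?thesis by (simp add: swap2_def[abs_def] pu_eq_px[abs_def] image_image)
qed

text \<open>Both sides are the same Cauchy integral of \<open>pu f\<close> over a circle in
  \<open>x\<close>.\<close>

lemma pu_px_commute:
  assumes U: "open U" and f: "f analytic2_on U" and p: "p \<in> U"
  shows "pu (px f) p = px (pu f) p"
proof -
  obtain x u where [simp]: "p = (x, u)" by (cases p)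
  obtain r where r: "r > 0" "cball x r \<times> cball u r \<subseteq> U" using open_polydisc[OF U] p by auto
  have g: "pu f analytic2_on U" by (rule analytic2_on_pu[OF U f])
  have "pu (px f) p = integral (cbox 0 1)
      (\<lambda>t. pu f (circ x r t, u) / (circ x r t - x) ^ 2 * circ' x r t)"
    using px_has_derivative_u[OF U f r(2,1)] r(1) by (auto simp: pu_def intro: DERIV_imp_deriv)
  also have "\<dots> = px (pu f) p"
  proof -
    have "(\<lambda>z. pu f (z, u)) field_differentiable at x" if "(x, u) \<in> U" for x u
      using analytic2_on_DERIV(1)[OF g that] field_differentiable_def by blast
    from px_eq_integral[OF analytic2_on_imp_continuous_on[OF g] r(2,1) this, of p]
    show ?thesis using r(1) by simp
  qed
  finally show ?thesis .
qed


section \<open>Existence of integral curves\<close>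

text \<open>One constant serves as bound and as Lipschitz constant, so that products stay in the class.\<close>

definition lipschitz_family ::
    "complex set \<Rightarrow> complex set \<Rightarrow> complex set \<Rightarrow> (complex \<Rightarrow> complex \<Rightarrow> complex \<Rightarrow> complex) \<Rightarrow> bool" where
  "lipschitz_family X Y Z F \<longleftrightarrow> (\<exists>L. \<forall>x\<in>X. \<forall>u\<in>Y. \<forall>w\<in>Z. norm (F x u w) \<le> L \<and>
     (\<forall>u'\<in>Y. \<forall>w'\<in>Z. norm (F x u w - F x u' w') \<le> L * (norm (u - u') + norm (w - w'))))"

text \<open>The constant may always be enlarged; at least 1, it can be divided by and multiplied
  into estimates safely.\<close>

lemma lipschitz_familyE:
  assumes "lipschitz_family X Y Z F"
  obtains L where "L \<ge> 1" "\<And>x u w. x \<in> X \<Longrightarrow> u \<in> Y \<Longrightarrow> w \<in> Z \<Longrightarrow> norm (F x u w) \<le> L"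
    "\<And>x u w u' w'. x \<in> X \<Longrightarrow> u \<in> Y \<Longrightarrow> w \<in> Z \<Longrightarrow> u' \<in> Y \<Longrightarrow> w' \<in> Z \<Longrightarrow>
       norm (F x u w - F x u' w') \<le> L * (norm (u - u') + norm (w - w'))"
proof -
  obtain L where L: "\<forall>x\<in>X. \<forall>u\<in>Y. \<forall>w\<in>Z. norm (F x u w) \<le> L \<and>
     (\<forall>u'\<in>Y. \<forall>w'\<in>Z. norm (F x u w - F x u' w') \<le> L * (norm (u - u') + norm (w - w')))"
    using assms unfolding lipschitz_family_def by blast
  have "L * (norm (u - u') + norm (w - w')) \<le> max L 1 * (norm (u - u') + norm (w - w'))"
    for u u' w w' :: complex
    by (intro mult_right_mono) auto
  then show ?thesis
    using L by (intro that[of "max L 1"]) (simp, simp add: le_max_iff_disj,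
      blast intro: order_trans)
qed

lemma lipschitz_family_add:
  assumes "lipschitz_family X Y Z F" "lipschitz_family X Y Z G"
  shows "lipschitz_family X Y Z (\<lambda>x u w. F x u w + G x u w)"
proof -
  obtain L where L: "L \<ge> 1" "\<And>x u w. x \<in> X \<Longrightarrow> u \<in> Y \<Longrightarrow> w \<in> Z \<Longrightarrow> norm (F x u w) \<le> L"
    "\<And>x u w u' w'. x \<in> X \<Longrightarrow> u \<in> Y \<Longrightarrow> w \<in> Z \<Longrightarrow> u' \<in> Y \<Longrightarrow> w' \<in> Z \<Longrightarrow>
       norm (F x u w - F x u' w') \<le> L * (norm (u - u') + norm (w - w'))"
         using lipschitz_familyE[OF assms(1)] by metis
  obtain K where K: "K \<ge> 1" "\<And>x u w. x \<in> X \<Longrightarrow> u \<in> Y \<Longrightarrow> w \<in> Z \<Longrightarrow> norm (G x u w) \<le> K"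
    "\<And>x u w u' w'. x \<in> X \<Longrightarrow> u \<in> Y \<Longrightarrow> w \<in> Z \<Longrightarrow> u' \<in> Y \<Longrightarrow> w' \<in> Z \<Longrightarrow>
       norm (G x u w - G x u' w') \<le> K * (norm (u - u') + norm (w - w'))"
         using lipschitz_familyE[OF assms(2)] by metis
  show ?thesis unfolding lipschitz_family_def
  proof (intro exI[of _ "L + K"] ballI conjI)
    fix x u w u' w' assume *: "x \<in> X" "u \<in> Y" "w \<in> Z"
    show "norm (F x u w + G x u w) \<le> L + K"
      using L(2)[OF *] K(2)[OF *] norm_triangle_ineq[of "F x u w" "G x u w"] by simp
    assume **: "u' \<in> Y" "w' \<in> Z"
    have "norm (F x u w + G x u w - (F x u' w' + G x u' w')) =
      norm ((F x u w - F x u' w') + (G x u w - G x u' w'))" by (simp add: algebra_simps)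
    also have "\<dots> \<le> norm (F x u w - F x u' w') + norm (G x u w - G x u' w')"
      by (rule norm_triangle_ineq)
    finally show "norm (F x u w + G x u w - (F x u' w' + G x u' w')) \<le>
      (L + K) * (norm (u - u') + norm (w - w'))"
      using L(3)[OF * **] K(3)[OF * **] by (simp add: algebra_simps)
  qed
qed

lemma lipschitz_family_mult:
  assumes "lipschitz_family X Y Z F" "lipschitz_family X Y Z G"
  shows "lipschitz_family X Y Z (\<lambda>x u w. F x u w * G x u w)"
proof -
  obtain L where L: "L \<ge> 1" "\<And>x u w. x \<in> X \<Longrightarrow> u \<in> Y \<Longrightarrow> w \<in> Z \<Longrightarrow> norm (F x u w) \<le> L"
    "\<And>x u w u' w'. x \<in> X \<Longrightarrow> u \<in> Y \<Longrightarrow> w \<in> Z \<Longrightarrow> u' \<in> Y \<Longrightarrow> w' \<in> Z \<Longrightarrow>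
       norm (F x u w - F x u' w') \<le> L * (norm (u - u') + norm (w - w'))"
         using lipschitz_familyE[OF assms(1)] by metis
  obtain K where K: "K \<ge> 1" "\<And>x u w. x \<in> X \<Longrightarrow> u \<in> Y \<Longrightarrow> w \<in> Z \<Longrightarrow> norm (G x u w) \<le> K"
    "\<And>x u w u' w'. x \<in> X \<Longrightarrow> u \<in> Y \<Longrightarrow> w \<in> Z \<Longrightarrow> u' \<in> Y \<Longrightarrow> w' \<in> Z \<Longrightarrow>
       norm (G x u w - G x u' w') \<le> K * (norm (u - u') + norm (w - w'))"
         using lipschitz_familyE[OF assms(2)] by metis
  show ?thesis unfolding lipschitz_family_def
  \<comment> \<open>Splitting \<open>FG - F'G'\<close> as \<open>F(G - G') + (F - F')G'\<close>,
    each of the two terms contributes \<open>L * K\<close>.\<close>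
  proof (intro exI[of _ "2 * L * K"] ballI conjI)
    fix x u w u' w' assume *: "x \<in> X" "u \<in> Y" "w \<in> Z"
    have "norm (F x u w * G x u w) \<le> L * K"
      using L K * by (simp add: norm_mult mult_mono)
    also have "\<dots> \<le> 2 * L * K" using L(1) K(1) by simp
    finally show "norm (F x u w * G x u w) \<le> 2 * L * K" .
    assume **: "u' \<in> Y" "w' \<in> Z"
    let ?d = "norm (u - u') + norm (w - w')"
    have "norm (F x u w * G x u w - F x u' w' * G x u' w') =
      norm (F x u w * (G x u w - G x u' w') + (F x u w - F x u' w') * G x u' w')"
      by (simp add: algebra_simps)
    also have "\<dots> \<le> norm (F x u w) * norm (G x u w - G x u' w') +
        norm (F x u w - F x u' w') * norm (G x u' w')"
      by (metis norm_mult norm_triangle_ineq)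
    also have "\<dots> \<le> L * (K * ?d) + (L * ?d) * K"
      using L(2)[OF *] K(2)[OF *(1) **] L(3)[OF * **] K(3)[OF * **] L(1) K(1)
      by (intro add_mono mult_mono) auto
    finally show "norm (F x u w * G x u w - F x u' w' * G x u' w') \<le> 2 * L * K * ?d"
      by (simp add: algebra_simps)
  qed
qed

lemma lipschitz_family_arg: "lipschitz_family X Y (cball v R) (\<lambda>x u w. w)"
  unfolding lipschitz_family_def
\<comment> \<open>\<open>norm v + R\<close> bounds the ball, and 1 is the Lipschitz constant of the
  projection to \<open>w\<close>.\<close>
proof (intro exI[of _ "max (norm v + R) 1"] ballI conjI)
  fix w assume "w \<in> cball v R"
  then have "norm w \<le> norm v + R"
    using norm_triangle_ineq2[of w v] by (simp add: dist_norm norm_minus_commute)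
  then show "norm w \<le> max (norm v + R) 1" by simp
next
  fix u u' w w' :: complex
  have "1 * (norm (u - u') + norm (w - w')) \<le> max (norm v + R) 1 * (norm (u - u') + norm (w - w'))"
    by (rule mult_right_mono) auto
  then show "norm (w - w') \<le> max (norm v + R) 1 * (norm (u - u') + norm (w - w'))"
    by (smt (verit) norm_ge_zero)
qed

text \<open>On the compact polydisc both \<open>f\<close> and \<open>pu f\<close> are bounded; the
  mean value inequality on the convex disc in \<open>u\<close> turns the second bound into a
  Lipschitz constant.\<close>

lemma lipschitz_family_analytic2:
  assumes U: "open U" and f: "f analytic2_on U" and sub: "cball x0 R \<times> cball u0 R \<subseteq> U"
  shows "lipschitz_family (cball x0 R) (cball u0 R) Z (\<lambda>x u w. f (x, u))"
proof -
  have cpt: "compact (cball x0 R \<times> cball u0 R)" by (intro compact_Times) auto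
  have bd: "\<exists>L. \<forall>p\<in>cball x0 R \<times> cball u0 R. norm (g p) \<le> L" if "g analytic2_on U" for g
    using compact_imp_bounded[OF compact_continuous_image[OF _ cpt, of g]]
      continuous_on_subset[OF analytic2_on_imp_continuous_on[OF that] sub]
    by (auto simp: bounded_iff)
  obtain L where L: "\<And>p. p \<in> cball x0 R \<times> cball u0 R \<Longrightarrow> norm (f p) \<le> L" using bd[OF f] by blast
  obtain K where K: "\<And>p. p \<in> cball x0 R \<times> cball u0 R \<Longrightarrow> norm (pu f p) \<le> K"
    using bd[OF analytic2_on_pu[OF U f]] by blast
  show ?thesis unfolding lipschitz_family_def
  proof (intro exI[of _ "max L K"] ballI conjI)
    fix x u assume x: "x \<in> cball x0 R" and u: "u \<in> cball u0 R"
    show "norm (f (x, u)) \<le> max L K" using L[of "(x, u)"] x u by (simp add: max_def)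
    fix u' w w' assume u': "u' \<in> cball u0 R"
    have "norm (f (x, u) - f (x, u')) \<le> K * norm (u - u')"
    proof (rule field_differentiable_bound[where f="\<lambda>z. f (x, z)"
      and f'="\<lambda>z. pu f (x, z)", OF convex_cball _ _ u u'])
      fix z assume z: "z \<in> cball u0 R"
      then have "(x, z) \<in> U" using x sub by auto
      then show "((\<lambda>z. f (x, z)) has_field_derivative pu f (x, z)) (at z within cball u0 R)"
        using analytic2_on_DERIV(2)[OF f] has_field_derivative_at_within by blast
      show "norm (pu f (x, z)) \<le> K" using K z x by auto
    qed
    also have "\<dots> \<le> max L K * (norm (u - u') + norm (w - w'))"
      using K[of "(x, u)"] x u order_trans[OF norm_ge_zero, of "pu f (x, u)" K]
      by (intro mult_mono) auto
    finally show "norm (f (x, u) - f (x, u')) \<le> max L K * (norm (u - u') + norm (w - w'))" .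
  qed
qed

text \<open>Telescoping makes the sequence a series dominated by a geometric one, to which
  Weierstrass's M-test applies.\<close>

lemma uniform_limit_geometric:
  fixes f :: "nat \<Rightarrow> 'a \<Rightarrow> 'b::banach"
  assumes "\<And>n x. x \<in> B \<Longrightarrow> norm (f (Suc n) x - f n x) \<le> c * (1/2) ^ n"
  obtains g where "uniform_limit B f g sequentially"
proof -
  have "summable (\<lambda>n. c * (1/2 :: real) ^ n)" by (intro summable_mult summable_geometric) auto
  from Weierstrass_m_test[OF assms this]
  have "uniform_limit B (\<lambda>n x. f 0 x + (\<Sum>i<n. f (Suc i) x - f i x))
      (\<lambda>x. f 0 x + (\<Sum>i. f (Suc i) x - f i x)) sequentially"
    by (intro uniform_limit_add uniform_limit_const)
  moreover have "f 0 x + (\<Sum>i<n. f (Suc i) x - f i x) = f n x" for n x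
    by (simp add: sum_lessThan_telescope[of "\<lambda>i. f i x"])
  ultimately show ?thesis using that by simp
qed

text \<open>Picard iteration for \<open>u' = w\<close>, \<open>w' = F x u w\<close>, with
  holomorphic primitives on a disc in place of integrals. The assumption \<open>hol\<close> is what
  analyticity of \<open>F\<close> in three variables would supply: substituting holomorphic
  functions gives an integrand with a primitive.\<close>

lemma holomorphic_system_solvable:
  fixes F :: "complex \<Rightarrow> complex \<Rightarrow> complex \<Rightarrow> complex"
  assumes R: "R > 0" and lip: "lipschitz_family (cball x0 R) (cball u0 R) (cball v R) F"
    and hol: "\<And>r f g. r \<le> R \<Longrightarrow> f holomorphic_on ball x0 r \<Longrightarrow> g holomorphic_on ball x0 r \<Longrightarrow>
      f ` ball x0 r \<subseteq> cball u0 R \<Longrightarrow> (\<lambda>x. F x (f x) (g x)) holomorphic_on ball x0 r"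
  obtains r f g where "r > 0" "r \<le> R" "f x0 = u0" "g x0 = v"
    "f ` ball x0 r \<subseteq> cball u0 R"
    "\<And>x. x \<in> ball x0 r \<Longrightarrow> (f has_field_derivative g x) (at x)"
    "\<And>x. x \<in> ball x0 r \<Longrightarrow> (g has_field_derivative F x (f x) (g x)) (at x)"
proof -
  obtain L where L: "L \<ge> 1"
    and FL: "\<And>x u w. x \<in> cball x0 R \<Longrightarrow> u \<in> cball u0 R \<Longrightarrow> w \<in> cball v R \<Longrightarrow> norm (F x u w) \<le> L"
    and lip: "\<And>x u w u' w'. x \<in> cball x0 R \<Longrightarrow> u \<in> cball u0 R \<Longrightarrow> w \<in> cball v R \<Longrightarrow> u' \<in> cball u0 R \<Longrightarrow>
      w' \<in> cball v R \<Longrightarrow>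
       norm (F x u w - F x u' w') \<le> L * (norm (u - u') + norm (w - w'))"
    using lipschitz_familyE[OF lip] by metis
  \<comment> \<open>A common bound for both right-hand sides on the balls: \<open>L\<close> for
    \<open>F\<close>, and \<open>norm v + R\<close> for \<open>w\<close>.\<close>
  define M where "M = L + norm v + R"
  have M: "M > 0" "L \<le> M" "norm v + R \<le> M" using L R by (auto simp: M_def add_pos_nonneg)
  \<comment> \<open>\<open>R\<close> keeps the disc in the domain and \<open>R / M\<close> keeps the
    iterates in their balls. \<open>1 / (4 * L)\<close> makes the error halve at each step: the
    Lipschitz bound adds the errors of both components, which costs one factor 2, and the halving
    another.\<close>
  define r where "r = Min {R, R / M, 1 / (4 * L)}"
  have r: "r > 0" "r \<le> R" "M * r \<le> R" "4 * L * r \<le> 1"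
  proof -
    show "r > 0" using R M(1) L by (simp add: r_def)
    have le: "r \<le> R" "r \<le> R / M" "r \<le> 1 / (4 * L)" by (simp_all add: r_def)
    show "r \<le> R" by fact
    show "M * r \<le> R" using le(2) M(1) by (simp add: field_simps)
    show "4 * L * r \<le> 1" using le(3) L by (simp add: field_simps)
  qed
  have r_half: "r \<le> 1/2"
  proof -
    have "1 * r \<le> L * r" using L r(1) by (intro mult_right_mono) auto
    then show ?thesis using r(1,4) by linarith
  qed
  let ?B = "ball x0 r"
  have x0: "x0 \<in> ?B" and BR: "?B \<subseteq> cball x0 R" using r by auto
  define P where "P = (\<lambda>(f, g). f holomorphic_on ?B \<and> g holomorphic_on ?B \<and> f x0 = u0 \<and> g x0 = v \<and>
    f ` ?B \<subseteq> cball u0 R \<and> g ` ?B \<subseteq> cball v R)"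
  \<comment> \<open>One Picard step in differential form; the initial values are fixed by
    \<open>P\<close>.\<close>
  define Q where "Q = (\<lambda>(f, g) (f1, g1). \<forall>x\<in>?B. (f1 has_field_derivative g x) (at x within ?B) \<and>
    (g1 has_field_derivative F x (f x) (g x)) (at x within ?B))"
  have bound: "norm (h x - h x0) \<le> K * r"
    if "\<And>x. x \<in> ?B \<Longrightarrow> (h has_field_derivative h' x) (at x within ?B)"
      "\<And>x. x \<in> ?B \<Longrightarrow> norm (h' x) \<le> K" "x \<in> ?B" for h h' K x
  proof -
    have "norm (h x - h x0) \<le> K * norm (x - x0)"
      by (rule field_differentiable_bound[OF convex_ball that(1,2) that(3) x0])
    also have "\<dots> \<le> K * r"
      using that(3) order_trans[OF norm_ge_zero that(2)[OF x0]]
      by (intro mult_left_mono) (auto simp: dist_norm norm_minus_commute)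
    finally show ?thesis .
  qed
  have primitive: "\<exists>h. h x0 = c \<and> (\<forall>x\<in>?B. (h has_field_derivative k x) (at x within ?B))"
    if k: "k holomorphic_on ?B" for k c
  proof -
    obtain h where "\<And>x. x \<in> ?B \<Longrightarrow> (h has_field_derivative k x) (at x within ?B)"
      using holomorphic_convex_primitive'[OF convex_ball open_ball k] by blast
    then show ?thesis
      by (intro exI[of _ "\<lambda>x. h x + (c - h x0)"]) (auto intro!: derivative_eq_intros)
  qed
  have norm_le: "norm w \<le> M" if "w \<in> cball v R" for w
    using that M(3) norm_triangle_ineq2[of w v] by (simp add: dist_norm norm_minus_commute)
  \<comment> \<open>Primitives are only known to exist, so the iterates are picked by dependent
    choice.\<close>
  have "\<exists>s. \<forall>n. P (s n) \<and> Q (s n) (s (Suc n))"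
  proof (rule dependent_nat_choice[where P="\<lambda>_. P" and Q="\<lambda>_. Q"])
    show "\<exists>fg. P fg" using R by (intro exI[of _ "(\<lambda>_. u0, \<lambda>_. v)"]) (auto simp: P_def)
  next
    fix fg :: "(complex \<Rightarrow> complex) \<times> (complex \<Rightarrow> complex)" and n :: nat
    assume "P fg"
    obtain f g where fg: "fg = (f, g)" by (cases fg)
    have f: "f holomorphic_on ?B" "f ` ?B \<subseteq> cball u0 R"
      and g: "g holomorphic_on ?B" "g ` ?B \<subseteq> cball v R"
      using \<open>P fg\<close> by (auto simp: fg P_def)
    obtain f1 where f1: "f1 x0 = u0" "\<And>x. x \<in> ?B \<Longrightarrow> (f1 has_field_derivative g x) (at x within ?B)"
      using primitive[OF g(1)] by blast
    obtain g1 where g1: "g1 x0 = v" "\<And>x. x \<in> ?B \<Longrightarrow>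
      (g1 has_field_derivative F x (f x) (g x)) (at x within ?B)"
      using primitive[OF hol[OF r(2) f(1) g(1) f(2)]] by blast
    have "f1 x \<in> cball u0 R" if "x \<in> ?B" for x
      using bound[OF f1(2) norm_le that] g(2) r(3) f1(1)
        by (force simp: dist_norm norm_minus_commute)
    moreover have "g1 x \<in> cball v R" if x: "x \<in> ?B" for x
    proof -
      have "norm (F y (f y) (g y)) \<le> M" if "y \<in> ?B" for y
        using that f(2) g(2) BR by (intro order_trans[OF FL M(2)]) blast+
      from bound[OF g1(2) this x] r(3) g1(1) show ?thesis
        by (simp add: dist_norm norm_minus_commute)
    qed
    moreover have "f1 holomorphic_on ?B" "g1 holomorphic_on ?B"
      using f1(2) g1(2) unfolding holomorphic_on_def field_differentiable_def by blast+
    ultimately have "P (f1, g1)" "Q fg (f1, g1)" using f1 g1 by (auto simp: P_def Q_def fg)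
    then show "\<exists>fg1. P fg1 \<and> Q fg fg1" by blast
  qed
  then obtain s where s: "\<And>n. P (s n)" "\<And>n. Q (s n) (s (Suc n))" by blast
  define f g where "f n = fst (s n)" and "g n = snd (s n)" for n
  have f: "f n x0 = u0" "\<And>x. x \<in> ?B \<Longrightarrow> f n x \<in> cball u0 R"
    and g: "g n x0 = v" "\<And>x. x \<in> ?B \<Longrightarrow> g n x \<in> cball v R" for n
    using s(1)[of n] unfolding P_def f_def g_def split_beta by blast+
  have df: "(f (Suc n) has_field_derivative g n x) (at x within ?B)"
    and dg: "(g (Suc n) has_field_derivative F x (f n x) (g n x)) (at x within ?B)" if "x \<in> ?B"
      for n x
    using s(2)[of n] that by (auto simp: Q_def f_def g_def split_beta)
  \<comment> \<open>\<open>2 * R\<close> is the diameter of the balls that hold all iterates, which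
    settles the base case.\<close>
  have step: "\<forall>x\<in>?B. norm (f (Suc n) x - f n x) \<le> 2 * R * (1/2) ^ n \<and>
    norm (g (Suc n) x - g n x) \<le> 2 * R * (1/2) ^ n" for n
  proof (induction n)
    case 0
    have "norm (a - b) \<le> 2 * R" if "a \<in> cball c R" "b \<in> cball c R" for a b c :: complex
      using that dist_triangle2[of a b c] by (simp add: dist_commute dist_norm[symmetric])
    then show ?case using f(2) g(2) by (metis mult.right_neutral power_0)
  next
    case (Suc n)
    show ?case
    proof (intro ballI conjI)
      fix x assume x: "x \<in> ?B"
      let ?c = "2 * R * (1/2) ^ n"
      have c: "?c \<ge> 0" using R by simp
      have "norm ((f (Suc (Suc n)) x - f (Suc n) x) - (f (Suc (Suc n)) x0 - f (Suc n) x0)) \<le> ?c * r"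
        by (rule bound[where h="\<lambda>x. f (Suc (Suc n)) x - f (Suc n) x"
          and h'="\<lambda>x. g (Suc n) x - g n x"])
          (rule DERIV_diff[OF df df], assumption+, use Suc x in auto)
      also have "\<dots> \<le> ?c * (1/2)" using c r_half by (intro mult_left_mono) auto
      finally show "norm (f (Suc (Suc n)) x - f (Suc n) x) \<le> 2 * R * (1/2) ^ Suc n" using f(1)
        by simp
      have "norm ((g (Suc (Suc n)) x - g (Suc n) x) - (g (Suc (Suc n)) x0 - g (Suc n) x0)) \<le>
        (2 * L * ?c) * r"
      proof (rule bound[where h="\<lambda>x. g (Suc (Suc n)) x - g (Suc n) x"
            and h'="\<lambda>x. F x (f (Suc n) x) (g (Suc n) x) - F x (f n x) (g n x)", OF _ _ x])
        fix x assume x: "x \<in> ?B"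
        show "((\<lambda>x. g (Suc (Suc n)) x - g (Suc n) x) has_field_derivative
           F x (f (Suc n) x) (g (Suc n) x) - F x (f n x) (g n x)) (at x within ?B)"
          by (intro DERIV_diff dg x)
        have "norm (F x (f (Suc n) x) (g (Suc n) x) - F x (f n x) (g n x)) \<le>
            L * (norm (f (Suc n) x - f n x) + norm (g (Suc n) x - g n x))"
          using x BR by (intro lip f g) auto
        also have "\<dots> \<le> L * (?c + ?c)" using Suc x L by (intro mult_left_mono add_mono) auto
        finally show "norm (F x (f (Suc n) x) (g (Suc n) x) - F x (f n x) (g n x)) \<le> 2 * L * ?c"
          by simp
      qed
      also have "(2 * L * ?c) * r = ?c * (2 * L * r)" by simp
      also have "\<dots> \<le> ?c * (1/2)" using c r(4) by (intro mult_left_mono) auto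
      finally show "norm (g (Suc (Suc n)) x - g (Suc n) x) \<le> 2 * R * (1/2) ^ Suc n" using g(1)
        by simp
    qed
  qed
  obtain \<phi> where \<phi>: "uniform_limit ?B f \<phi> sequentially"
    using uniform_limit_geometric[of ?B f "2 * R"] step by blast
  obtain \<gamma> where \<gamma>: "uniform_limit ?B g \<gamma> sequentially"
    using uniform_limit_geometric[of ?B g "2 * R"] step by blast
  have lim: "(\<lambda>n. f n x) \<longlonglongrightarrow> \<phi> x" "(\<lambda>n. g n x) \<longlonglongrightarrow> \<gamma> x" if "x \<in> ?B" for x
    using tendsto_uniform_limitI[OF \<phi> that] tendsto_uniform_limitI[OF \<gamma> that] by auto
  have \<phi>R: "\<phi> x \<in> cball u0 R" and \<gamma>R: "\<gamma> x \<in> cball v R" if "x \<in> ?B" for x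
    using closed_sequentially[OF closed_cball _ lim(1)[OF that]] f(2)[OF that]
      closed_sequentially[OF closed_cball _ lim(2)[OF that]] g(2)[OF that] by blast+
  \<comment> \<open>Uniform convergence of the derivatives of the iterates, which allows the limits
    to be differentiated.\<close>
  have ev: "\<exists>N. \<forall>n x. n \<ge> N \<longrightarrow> x \<in> ?B \<longrightarrow> norm (g n x - \<gamma> x) \<le> e \<and>
      norm (F x (f n x) (g n x) - F x (\<phi> x) (\<gamma> x)) \<le> e" if e: "e > 0" for e
  proof -
    \<comment> \<open>The Lipschitz estimate multiplies the sum of two errors by
      \<open>L\<close>.\<close>
    define e' where "e' = e / (2 * L)"
    have e': "e' > 0" "L * (e' + e') = e" "e' \<le> e" using e L by (auto simp: e'_def field_simps)
    have "\<forall>\<^sub>F n in sequentially. \<forall>x\<in>?B. norm (f n x - \<phi> x) < e' \<and> norm (g n x - \<gamma> x) < e'"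
      using uniform_limitD[OF \<phi> e'(1)] uniform_limitD[OF \<gamma> e'(1)]
      by eventually_elim (auto simp: dist_norm)
    then obtain N where N: "\<And>n x. n \<ge> N \<Longrightarrow> x \<in> ?B \<Longrightarrow> norm (f n x - \<phi> x) < e' \<and>
      norm (g n x - \<gamma> x) < e'"
      unfolding eventually_sequentially by blast
    show ?thesis
    proof (intro exI[of _ N] allI impI conjI)
      fix n x assume n: "n \<ge> N" and x: "x \<in> ?B"
      show "norm (g n x - \<gamma> x) \<le> e" using N[OF n x] e'(3) by simp
      have "norm (F x (f n x) (g n x) - F x (\<phi> x) (\<gamma> x)) \<le> L * (norm (f n x - \<phi> x)
        + norm (g n x - \<gamma> x))"
        using x BR by (intro lip f g \<phi>R \<gamma>R) auto
      also have "\<dots> \<le> L * (e' + e')" using N[OF n x] L by (intro mult_left_mono add_mono) auto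
      finally show "norm (F x (f n x) (g n x) - F x (\<phi> x) (\<gamma> x)) \<le> e" using e'(2) by simp
    qed
  qed
  \<comment> \<open>The theorem on sequences of derivatives produces some limit \<open>H\<close>,
    identified with \<open>\<psi>\<close> by uniqueness of limits. The index is shifted because the
    derivative of iterate \<open>Suc n\<close> is expressed through iterate
    \<open>n\<close>.\<close>
  have limit_deriv: "(\<psi> has_field_derivative k' x) (at x)"
    if dh: "\<And>n x. x \<in> ?B \<Longrightarrow> (h (Suc n) has_field_derivative k n x) (at x within ?B)"
      and lh: "\<And>x. x \<in> ?B \<Longrightarrow> (\<lambda>n. h n x) \<longlonglongrightarrow> \<psi> x"
      and k: "\<And>e. e > 0 \<Longrightarrow> \<exists>N. \<forall>n x. n \<ge> N \<longrightarrow> x \<in> ?B \<longrightarrow> norm (k n x - k' x) \<le> e"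
      and x: "x \<in> ?B" for h k k' \<psi> x
  proof -
    have "\<exists>x l. x \<in> ?B \<and> (\<lambda>n. h (Suc n) x) \<longlonglongrightarrow> l"
      using LIMSEQ_Suc[OF lh[OF x0]] x0 by blast
    from has_complex_derivative_sequence[OF convex_ball dh k this]
    obtain H where H: "\<And>x. x \<in> ?B \<Longrightarrow> (\<lambda>n. h (Suc n) x) \<longlonglongrightarrow> H x"
      "\<And>x. x \<in> ?B \<Longrightarrow> (H has_field_derivative k' x) (at x within ?B)" by blast
    have "H x = \<psi> x" if "x \<in> ?B" for x
      using LIMSEQ_unique[OF H(1) LIMSEQ_Suc[OF lh]] that by blast
    then show ?thesis
      using has_field_derivative_transform_within_open[OF _ open_ball x, of H "k' x" \<psi>] H(2)[OF x]
        at_within_open[OF x] by simp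
  qed
  show ?thesis
  proof (rule that[of r \<phi> \<gamma>])
    show "\<phi> x0 = u0" using lim(1)[OF x0] f(1) LIMSEQ_unique[OF _ tendsto_const] by fastforce
    show "\<gamma> x0 = v" using lim(2)[OF x0] g(1) LIMSEQ_unique[OF _ tendsto_const] by fastforce
    show "\<phi> ` ?B \<subseteq> cball u0 R" using \<phi>R by blast
    show "(\<phi> has_field_derivative \<gamma> x) (at x)" if "x \<in> ?B" for x
      by (rule limit_deriv[OF df lim(1) _ that]) (use ev in blast)+
    show "(\<gamma> has_field_derivative F x (\<phi> x) (\<gamma> x)) (at x)" if "x \<in> ?B" for x
      by (rule limit_deriv[OF dg lim(2) _ that]) (use ev in blast)+
  qed (use r in auto)
qed

text \<open>The second-order equation is solved as a system for \<open>u\<close> and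
  \<open>u'\<close>. Curves parametrised by \<open>x\<close> miss only the direction
  \<open>dx = 0\<close>, and the finite slopes \<open>v\<close> suffice to identify a cubic.\<close>

lemma integral_curve_exists:
  assumes U: "open U" and co: "analytic_coeffs U A B C D" and p: "(x0, u0) \<in> U"
  obtains T f where "x0 \<in> T" "(T, (\<lambda>x. x), f) \<in> integral_curves U A B C D"
    "f x0 = u0" "deriv f x0 = v"
proof -
  have an: "A analytic2_on U" "B analytic2_on U" "C analytic2_on U" "D analytic2_on U"
    using co by (auto simp: analytic_coeffs_def)
  obtain R where R: "R > 0" "cball x0 R \<times> cball u0 R \<subseteq> U" using open_polydisc[OF U p] by blast
  \<comment> \<open>Powers are written as nested products to fit the closure rules for
    \<open>lipschitz_family\<close>.\<close>
  define F where "F x u w = A (x, u) + B (x, u) * w + C (x, u) * (w * w)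
    + D (x, u) * (w * (w * w))" for x u w
  note lip = lipschitz_family_analytic2[OF U _ R(2)]
  have lipF: "lipschitz_family (cball x0 R) (cball u0 R) (cball v R) F"
    unfolding F_def
    by (intro lipschitz_family_add lipschitz_family_mult lipschitz_family_arg lip an)
  have holF: "(\<lambda>x. F x (f x) (g x)) holomorphic_on ball x0 r"
    if "r \<le> R" "f holomorphic_on ball x0 r" "g holomorphic_on ball x0 r"
      "f ` ball x0 r \<subseteq> cball u0 R" for r f g
  proof -
    have "(\<lambda>x. h (x, f x)) holomorphic_on ball x0 r" if "h analytic2_on U" for h
      unfolding holomorphic_on_open[OF open_ball]
    proof
      fix x assume x: "x \<in> ball x0 r"
      then have "(f has_field_derivative deriv f x) (at x)"
        using \<open>f holomorphic_on ball x0 r\<close> holomorphic_derivI by blast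
      moreover have "(x, f x) \<in> U" using x R(2) \<open>r \<le> R\<close> \<open>f ` ball x0 r \<subseteq> cball u0 R\<close> by force
      ultimately show "\<exists>f'. ((\<lambda>x. h (x, f x)) has_field_derivative f') (at x)"
        using analytic2_on_chain[OF \<open>h analytic2_on U\<close>, where \<xi>="\<lambda>x. x"] DERIV_ident by blast
    qed
    then show ?thesis unfolding F_def using an that(3) by (intro holomorphic_intros) auto
  qed
  obtain r f g where r: "r > 0" "r \<le> R" and f0: "f x0 = u0" "g x0 = v"
    and fR: "f ` ball x0 r \<subseteq> cball u0 R"
    and df: "\<And>x. x \<in> ball x0 r \<Longrightarrow> (f has_field_derivative g x) (at x)"
    and dg: "\<And>x. x \<in> ball x0 r \<Longrightarrow> (g has_field_derivative F x (f x) (g x)) (at x)"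
    using holomorphic_system_solvable[OF R(1) lipF holF] by blast
  have deriv_f: "deriv f x = g x" if "x \<in> ball x0 r" for x using df[OF that]
    by (rule DERIV_imp_deriv)
  have deriv2_f: "deriv (deriv f) x = F x (f x) (g x)" if "x \<in> ball x0 r" for x
  proof (rule DERIV_imp_deriv, rule has_field_derivative_transform_within_open[OF dg[OF that]
    open_ball that])
    show "g y = deriv f y" if "y \<in> ball x0 r" for y using deriv_f[OF that] by simp
  qed
  have "f holomorphic_on ball x0 r" using df unfolding holomorphic_on_open[OF open_ball] by blast
  moreover have "(x, f x) \<in> U" if "x \<in> ball x0 r" for x using that R(2) r(2) fR by force
  ultimately have "surface_curve U (ball x0 r) (\<lambda>x. x) f"
    using r(1) by (auto simp: surface_curve_def intro: holomorphic_intros)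
  then have "(ball x0 r, (\<lambda>x. x), f) \<in> integral_curves U A B C D"
    by (auto simp: integral_curves_def deriv_f deriv2_f F_def power2_eq_square power3_eq_cube)
  then show ?thesis using that[of "ball x0 r" f] r(1) f0 deriv_f[of x0] by simp
qed

text \<open>The values at 0, 1, -1 and 2 already determine a cubic.\<close>

lemma cubic_eq_0_imp_coeffs_eq_0:
  fixes a b c d :: complex
  assumes "\<And>v. a + b * v + c * v ^ 2 + d * v ^ 3 = 0"
  shows "a = 0 \<and> b = 0 \<and> c = 0 \<and> d = 0"
proof -
  have a: "a = 0" using assms[of 0] by simp
  have 1: "b + c + d = 0" using assms[of 1] a by simp
  have 2: "c = b + d" using assms[of "-1"] a by (simp add: algebra_simps)
  have 3: "2 * b + 4 * c + 8 * d = 0" using assms[of 2] a by (simp add: algebra_simps)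
  have c: "c = 0" using 1 2
    by (metis add.left_commute add.commute mult_2 mult_eq_0_iff zero_neq_numeral)
  then have b: "b = - d" using 2 by (simp add: eq_neg_iff_add_eq_0)
  then have "6 * d = 0" using 3 c by (simp add: algebra_simps)
  then show ?thesis using a b c by simp
qed

text \<open>A curve through \<open>p\<close> of slope \<open>v\<close> satisfies both equations with
  the same \<open>u''\<close>, so the two cubics agree at \<open>v\<close>; and \<open>v\<close> is
  arbitrary.\<close>

lemma integral_curves_determine_coeffs:
  assumes U: "open U" and co: "analytic_coeffs U A B C D"
    and eq: "integral_curves U A B C D = integral_curves U A' B' C' D'"
    and p: "p \<in> U"
  shows "A' p = A p \<and> B' p = B p \<and> C' p = C p \<and> D' p = D p"
proof -
  obtain x0 u0 where p_eq: "p = (x0, u0)" by (cases p)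
  have "(A' p - A p) + (B' p - B p) * v + (C' p - C p) * v ^ 2 + (D' p - D p) * v ^ 3 = 0" for v
  proof -
    obtain T f where T: "x0 \<in> T" "(T, (\<lambda>x. x), f) \<in> integral_curves U A B C D" "f x0 = u0"
      "deriv f x0 = v"
      using integral_curve_exists[OF U co, of x0 u0 v] p p_eq by metis
    moreover have "(T, (\<lambda>x. x), f) \<in> integral_curves U A' B' C' D'" using T(2) eq by simp
    ultimately have "A p + B p * v + C p * v ^ 2 + D p * v ^ 3 = A' p + B' p * v + C' p * v ^ 2
      + D' p * v ^ 3"
      unfolding integral_curves_def p_eq by force
    then show ?thesis by (simp add: algebra_simps)
  qed
  from cubic_eq_0_imp_coeffs_eq_0[OF this] show ?thesis by simp
qed


section \<open>Planes in a five-dimensional space\<close>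

lemma mem_span1:
  fixes a :: "complex ^ 'n"
  shows "x \<in> vec.span {a} \<longleftrightarrow> (\<exists>k. x = k *s a)"
  unfolding vec.span_singleton by (simp add: image_iff)

lemma mem_span2:
  fixes a b :: "complex ^ 'n"
  shows "x \<in> vec.span {a, b} \<longleftrightarrow> (\<exists>k l. x = k *s a + l *s b)"
  unfolding vec.span_breakdown_eq[of x a] mem_span1
  by (simp add: diff_eq_eq add.commute)

lemma mem_span3:
  fixes a b c :: "complex ^ 'n"
  shows "x \<in> vec.span {a, b, c} \<longleftrightarrow> (\<exists>k l m. x = k *s a + l *s b + m *s c)"
  unfolding vec.span_breakdown_eq[of x a] mem_span2 by (simp add: diff_eq_eq algebra_simps)

lemma mem_span5:
  fixes a b c d e :: "complex ^ 'n"
  shows "x \<in> vec.span {a, b, c, d, e} \<longleftrightarrow>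
    (\<exists>k l m n p. x = k *s a + l *s b + m *s c + n *s d + p *s e)"
proof -
  have "x \<in> vec.span {a, b, c, d, e} \<longleftrightarrow> (\<exists>k l m n p. x - k *s a - l *s b = m *s c + n *s d + p *s e)"
    by (auto simp: vec.span_breakdown_eq[where S="{b, c, d, e}"]
        vec.span_breakdown_eq[where S="{c, d, e}"] mem_span3)
  also have "\<dots> \<longleftrightarrow> (\<exists>k l m n p. x = k *s a + l *s b + m *s c + n *s d + p *s e)"
    by (simp add: algebra_simps)
  finally show ?thesis .
qed

section \<open>Families of five vectors and the analyticity of their coefficients\<close>

lemma exhaust_5:
  fixes x :: 5
  shows "x = 1 \<or> x = 2 \<or> x = 3 \<or> x = 4 \<or> x = 5"
proof (induct x)
  case (of_int z)
  then have "z = 0 \<or> z = 1 \<or> z = 2 \<or> z = 3 \<or> z = 4" by fastforce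
  then show ?case by auto
qed

lemma UNIV_5: "UNIV = {1, 2, 3, 4, 5::5}"
  using exhaust_5 by auto

lemma sum_5: "sum f (UNIV::5 set) = f 1 + f 2 + f 3 + f 4 + f 5"
  unfolding UNIV_5 by (simp add: ac_simps)

text \<open>Turns five named vectors into an indexed family, so that injectivity makes sense and
  coefficients live in \<open>complex ^ 5\<close>.\<close>

definition vec5 :: "'a \<Rightarrow> 'a \<Rightarrow> 'a \<Rightarrow> 'a \<Rightarrow> 'a \<Rightarrow> 5 \<Rightarrow> 'a" where
  "vec5 a b c d e i = (if i = 1 then a else if i = 2 then b else if i = 3 then c else
    if i = 4 then d else e)"

lemma vec5_simps [simp]:
  "vec5 a b c d e 1 = a" "vec5 a b c d e 2 = b" "vec5 a b c d e 3 = c" "vec5 a b c d e 4 = d"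
  "vec5 a b c d e 5 = e"
  by (simp_all add: vec5_def)

lemma range_vec5: "range (vec5 a b c d e) = {a, b, c, d, e}"
  by (simp add: UNIV_5)

text \<open>Dimension is at most the number of distinct vectors, which is at most the number of
  indices; equality throughout excludes repetitions as well as relations.\<close>

lemma dim_range_eq_card:
  fixes v :: "'k::finite \<Rightarrow> complex ^ 'n"
  assumes "vec.dim (range v) = CARD('k)"
  shows "inj v" "vec.independent (range v)"
proof -
  have "card (range v) \<le> CARD('k)" "vec.dim (range v) \<le> card (range v)"
    by (auto intro: card_image_le vec.dim_le_card')
  then have c: "card (range v) = CARD('k)" using assms by simp
  then show "inj v" by (simp add: eq_card_imp_inj_on)
  show "vec.independent (range v)"
    by (rule vec.card_le_dim_spanning[of "range v" "range v"])
      (use c assms in \<open>auto intro: vec.span_base\<close>)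
qed

text \<open>
  A fixed linear map sends the vectors at \<open>p\<close> to the standard basis; near \<open>p\<close> the coefficients are
  then given by Cramer's rule.
\<close>

lemma coefficients_analytic:
  fixes v :: "'k::finite \<Rightarrow> complex \<times> complex \<Rightarrow> complex ^ 'n"
    and c :: "complex \<times> complex \<Rightarrow> complex ^ 'k"
  assumes v: "\<And>i. v i vanalytic2_on {p}" and z: "z vanalytic2_on {p}"
    and ind: "inj (\<lambda>i. v i p)" "vec.independent (range (\<lambda>i. v i p))"
    and ev: "\<forall>\<^sub>F q in nhds p. z q = (\<Sum>i\<in>UNIV. c q $ i *s v i q)"
  shows "(\<lambda>q. c q $ k) analytic2_on {p}"
proof -
  obtain g :: "complex ^ 'n \<Rightarrow> complex ^ 'k" where g: "Vector_Spaces.linear (*s) (*s) g"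
    and gv: "\<And>i. g (v i p) = axis i 1"
    using vec.linear_independent_extend[OF ind(2), of "\<lambda>x. axis (inv (\<lambda>i. v i p) x) 1"]
      inv_f_f[OF ind(1)] by (metis (lifting) rangeI)
  define M where "M q = (\<chi> j i. g (v i q) $ j)" for q
  have g_an: "(\<lambda>q. g (h q) $ j) analytic2_on {p}" if "h vanalytic2_on {p}" for h j
  proof -
    have "g (h q) $ j = (\<Sum>i\<in>UNIV. matrix g $ j $ i * h q $ i)" for q
      by (subst matrix_works[OF g, symmetric]) (simp add: matrix_vector_mult_def)
    then show ?thesis using that by (auto simp: vanalytic2_on_def intro!: analytic2_intros)
  qed
  have M_an: "(\<lambda>q. M q $ i $ j) analytic2_on {p}" for i j by (simp add: M_def g_an v)
  have det_an: "(\<lambda>q. det (N q)) analytic2_on {p}" if "\<And>i j. (\<lambda>q. N q $ i $ j) analytic2_on {p}"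
    for N :: "complex \<times> complex \<Rightarrow> complex ^ 'k ^ 'k"
    unfolding det_def by (intro analytic2_intros that)
  have M_det: "det (M p) = 1"
  proof -
    have "M p = mat 1" by (simp add: M_def gv mat_def axis_def vec_eq_iff)
    then show ?thesis by simp
  qed
  have "isCont (\<lambda>q. det (M q)) p"
    using det_an[OF M_an] has_derivative_continuous unfolding analytic2_on_def by blast
  then have "((\<lambda>q. det (M q)) \<longlongrightarrow> 1) (nhds p)"
    using tendsto_at_iff_tendsto_nhds[of "\<lambda>q. det (M q)" p] by (simp add: isCont_def M_det)
  then have det_ne: "\<forall>\<^sub>F q in nhds p. det (M q) \<noteq> 0"
    by (rule tendsto_imp_eventually_ne) simp
  define N where "N q = (\<chi> i j. if j = k then g (z q) $ i else M q $ i $ j)" for q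
  \<comment> \<open>Where the determinant is nonzero, \<open>c\<close>, about which no regularity is
    assumed, is forced to be Cramer's quotient.\<close>
  have "\<forall>\<^sub>F q in nhds p. det (N q) * inverse (det (M q)) = c q $ k"
    using det_ne ev
  proof eventually_elim
    case (elim q)
    have "g (z q) = (\<Sum>i\<in>UNIV. c q $ i *s g (v i q))"
      unfolding elim(2) vec.linear_sum[OF g] vec.linear_scale[OF g] ..
    also have "\<dots> = M q *v c q"
      by (simp add: M_def matrix_vector_mult_def vec_eq_iff mult.commute)
    finally have "c q = (\<chi> k. det (\<chi> i j. if j = k then g (z q) $ i else M q $ i $ j) / det (M q))"
      using cramer[OF elim(1), of "c q" "g (z q)"] by simp
    from arg_cong[OF this, of "\<lambda>w. w $ k"] show ?case by (simp add: N_def divide_inverse)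
  qed
  moreover have "(\<lambda>q. det (N q) * inverse (det (M q))) analytic2_on {p}"
  proof (intro analytic2_intros det_an M_an)
    show "(\<lambda>q. N q $ i $ j) analytic2_on {p}" for i j
      by (cases "j = k") (simp_all add: N_def M_an g_an z)
  qed (simp add: M_det)
  ultimately show ?thesis by (rule analytic2_on_cong_at[rotated])
qed

text \<open>Besides \<open>e0\<close>, the plane is the graph of a linear map from the span of
  \<open>e3, e4\<close> to that of \<open>e1, e2\<close>; the Greek parameters are the entries of
  its matrix.\<close>

definition normal_plane ::
  "complex ^ 'n \<Rightarrow> complex ^ 'n \<Rightarrow> complex ^ 'n \<Rightarrow> complex ^ 'n \<Rightarrow> complex ^ 'n \<Rightarrow>
    complex \<Rightarrow> complex \<Rightarrow> complex \<Rightarrow> complex \<Rightarrow> (complex ^ 'n) set" where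
  "normal_plane e0 e1 e2 e3 e4 \<alpha> \<beta> \<gamma> \<delta> =
     vec.span {e0, \<alpha> *s e1 + \<beta> *s e2 + e3, \<gamma> *s e1 + \<delta> *s e2 + e4}"

locale frame =
  fixes e0 e1 e2 e3 e4 :: "complex ^ 'n"
  assumes dim_frame: "vec.dim {e0, e1, e2, e3, e4} = 5"
begin

abbreviation "plane \<equiv> normal_plane e0 e1 e2 e3 e4"

lemma coords_zero:
  assumes *: "k *s e0 + l *s e1 + m *s e2 + n *s e3 + p *s e4 = 0"
  shows "k = 0 \<and> l = 0 \<and> m = 0 \<and> n = 0 \<and> p = 0"
proof -
  let ?v = "vec5 e0 e1 e2 e3 e4" and ?k = "vec5 k l m n p"
  have v: "inj ?v" "vec.independent (range ?v)"
    using dim_range_eq_card[of ?v] dim_frame by (simp_all add: range_vec5)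
  \<comment> \<open>\<open>vec.independent_explicit\<close> takes coefficients as a function on the
    vectors, so \<open>inv ?v\<close> carries the indexed ones over.\<close>
  have "(\<Sum>x\<in>range ?v. ?k (inv ?v x) *s x) = (\<Sum>i\<in>UNIV. ?k i *s ?v i)"
    using v(1) by (simp add: sum.reindex)
  also have "\<dots> = 0" using * by (simp add: sum_5)
  finally have "\<forall>x\<in>range ?v. ?k (inv ?v x) = 0"
    using v(2)[unfolded vec.independent_explicit, THEN conjunct2, THEN spec,
      of "\<lambda>x. ?k (inv ?v x)"] by simp
  then have "?k i = 0" for i using v(1) by auto
  from this[of 1] this[of 2] this[of 3] this[of 4] this[of 5]
  show ?thesis by simp
qed

lemma coords_eq:
  assumes "k *s e0 + l *s e1 + m *s e2 + n *s e3 + p *s e4 = k' *s e0 + l' *s e1 + m' *s e2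
    + n' *s e3 + p' *s e4"
  shows "k = k' \<and> l = l' \<and> m = m' \<and> n = n' \<and> p = p'"
proof -
  have "(k - k') *s e0 + (l - l') *s e1 + (m - m') *s e2 + (n - n') *s e3 + (p - p') *s e4 = 0"
    using assms by (simp add: vec_eq_iff algebra_simps)
  from coords_zero[OF this] show ?thesis by simp
qed

lemma e0_nonzero: "e0 \<noteq> 0"
  using coords_zero[of 1 0 0 0 0] by auto

lemma mem_plane:
  "x \<in> plane \<alpha> \<beta> \<gamma> \<delta> \<longleftrightarrow>
    (\<exists>k m n. x = k *s e0 + (m * \<alpha> + n * \<gamma>) *s e1 + (m * \<beta> + n * \<delta>) *s e2 + m *s e3 + n *s e4)"
  unfolding normal_plane_def mem_span3 by (simp add: vec_eq_iff algebra_simps)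

lemma dim_plane: "vec.dim (plane \<alpha> \<beta> \<gamma> \<delta>) = 3"
proof -
  let ?w1 = "\<alpha> *s e1 + \<beta> *s e2 + e3" and ?w2 = "\<gamma> *s e1 + \<delta> *s e2 + e4"
  have "e0 \<notin> vec.span {?w1, ?w2}"
  proof
    assume "e0 \<in> vec.span {?w1, ?w2}"
    then obtain k l where "e0 = k *s ?w1 + l *s ?w2" unfolding mem_span2 by blast
    then have "(-1) *s e0 + (k * \<alpha> + l * \<gamma>) *s e1 + (k * \<beta> + l * \<delta>) *s e2 + k *s e3 + l *s e4 = 0"
      by (simp add: vec_eq_iff algebra_simps)
    from coords_zero[OF this] show False by simp
  qed
  moreover have "?w1 \<notin> vec.span {?w2}"
  proof
    assume "?w1 \<in> vec.span {?w2}"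
    then obtain l where "?w1 = l *s ?w2" unfolding mem_span1 by blast
    then have "0 *s e0 + (\<alpha> - l * \<gamma>) *s e1 + (\<beta> - l * \<delta>) *s e2 + 1 *s e3 + (- l) *s e4 = 0"
      by (simp add: vec_eq_iff algebra_simps)
    from coords_zero[OF this] show False by simp
  qed
  moreover have "?w2 \<noteq> 0"
    using coords_zero[of 0 \<gamma> \<delta> 0 1] by (auto simp: add.assoc)
  ultimately show ?thesis unfolding normal_plane_def by (simp add: vec.dim_insert)
qed

text \<open>Tangent vectors have zero coordinates at \<open>e3\<close> and \<open>e4\<close>, and in
  the plane these are the two coefficients besides that of \<open>e0\<close>.\<close>

lemma plane_meets_tangent: "plane \<alpha> \<beta> \<gamma> \<delta> \<inter> vec.span {e0, e1, e2} = vec.span {e0}"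
proof (intro equalityI subsetI IntI)
  fix x assume "x \<in> plane \<alpha> \<beta> \<gamma> \<delta> \<inter> vec.span {e0, e1, e2}"
  then obtain k m n k' l' m' where
    x: "x = k *s e0 + (m * \<alpha> + n * \<gamma>) *s e1 + (m * \<beta> + n * \<delta>) *s e2 + m *s e3 + n *s e4"
    and "x = k' *s e0 + l' *s e1 + m' *s e2"
    unfolding Int_iff mem_plane mem_span3 by blast
  then have "k *s e0 + (m * \<alpha> + n * \<gamma>) *s e1 + (m * \<beta> + n * \<delta>) *s e2 + m *s e3 + n *s e4 =
    k' *s e0 + l' *s e1 + m' *s e2 + 0 *s e3 + 0 *s e4" by simp
  then have "m = 0 \<and> n = 0" using coords_eq by metis
  then show "x \<in> vec.span {e0}" using x by (simp add: mem_span1)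
next
  fix x assume "x \<in> vec.span {e0}"
  then show "x \<in> plane \<alpha> \<beta> \<gamma> \<delta>" "x \<in> vec.span {e0, e1, e2}"
    unfolding normal_plane_def by (meson insert_mono empty_subsetI vec.span_mono subsetD)+
qed

lemma plane_subset: "plane \<alpha> \<beta> \<gamma> \<delta> \<subseteq> vec.span {e0, e1, e2, e3, e4}"
  unfolding subset_iff mem_plane mem_span5 by blast

text \<open>Since 3 + 3 - 1 = 5, \<omega> and the tangent plane together span the whole space, so
  \<open>e3\<close> and \<open>e4\<close> can be moved into \<omega> by tangent vectors.\<close>

lemma normal_form:
  assumes sub: "vec.subspace \<omega>" "\<omega> \<subseteq> vec.span {e0, e1, e2, e3, e4}" and dim: "vec.dim \<omega> = 3"
    and tangent: "\<omega> \<inter> vec.span {e0, e1, e2} = vec.span {e0}"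
  obtains \<alpha> \<beta> \<gamma> \<delta> where "\<omega> = plane \<alpha> \<beta> \<gamma> \<delta>"
proof -
  let ?P = "vec.span {e0, e1, e2}" and ?S = "vec.span {e0, e1, e2, e3, e4}"
  have e0: "e0 \<in> \<omega>" using tangent vec.span_base[of e0 "{e0}"] by blast
  \<comment> \<open>Adjoining \<open>e3\<close> and \<open>e4\<close> raises the dimension by at
    most 2 and must reach 5.\<close>
  have dimP: "vec.dim ?P = 3"
  proof -
    have "vec.dim {e0, e1, e2} \<le> card {e0, e1, e2}" by (rule vec.dim_le_card') simp
    also have "\<dots> \<le> 3" by (simp add: card_insert_if)
    finally have "vec.dim {e0, e1, e2} \<le> 3" .
    moreover have "vec.dim (insert e3 (insert e4 {e0, e1, e2})) = 5"
      using dim_frame by (simp add: insert_commute)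
    ultimately show ?thesis by (simp add: vec.dim_insert split: if_splits)
  qed
  have dimS: "vec.dim ?S = 5" using dim_frame by simp
  let ?Q = "{x + y |x y. x \<in> \<omega> \<and> y \<in> ?P}"
  have "vec.dim ?Q + vec.dim (\<omega> \<inter> ?P) = vec.dim \<omega> + vec.dim ?P"
    by (rule vec.dim_sums_Int[OF sub(1) vec.subspace_span])
  moreover have "vec.dim (\<omega> \<inter> ?P) = 1" using tangent e0_nonzero by (simp add: vec.dim_insert)
  ultimately have "vec.dim ?Q = 5" using dim dimP by simp
  moreover have "?Q \<subseteq> ?S"
    using sub(2) vec.span_mono[of "{e0, e1, e2}" "{e0, e1, e2, e3, e4}"]
      by (auto intro!: vec.span_add)
  moreover have "vec.subspace ?Q" by (rule vec.subspace_sums[OF sub(1) vec.subspace_span])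
  ultimately have Q: "?Q = ?S"
    using vec.subspace_dim_equal[OF _ vec.subspace_span, of ?Q] dimS by simp
  \<comment> \<open>Of the tangent part of \<open>e\<close>, the multiple of \<open>e0\<close>
    already lies in \<omega> and is absorbed there; only \<open>e1\<close> and \<open>e2\<close>
    remain.\<close>
  have *: "\<exists>\<alpha> \<beta>. \<alpha> *s e1 + \<beta> *s e2 + e \<in> \<omega>" if "e \<in> ?S" for e
  proof -
    from that obtain w k l m where w: "w \<in> \<omega>" "e = w + (k *s e0 + l *s e1 + m *s e2)"
      unfolding Q[symmetric] mem_span3 by blast
    then have "w + k *s e0 \<in> \<omega>" using e0 sub(1) by (intro vec.subspace_add vec.subspace_scale)
    moreover have "w + k *s e0 = (-l) *s e1 + (-m) *s e2 + e" using w(2) by (simp add: vec_eq_iff)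
    ultimately show ?thesis by metis
  qed
  obtain \<alpha> \<beta> where 3: "\<alpha> *s e1 + \<beta> *s e2 + e3 \<in> \<omega>" using *[of e3] by (auto simp: vec.span_base)
  obtain \<gamma> \<delta> where 4: "\<gamma> *s e1 + \<delta> *s e2 + e4 \<in> \<omega>" using *[of e4] by (auto simp: vec.span_base)
  have "plane \<alpha> \<beta> \<gamma> \<delta> \<subseteq> \<omega>" unfolding normal_plane_def
    using e0 3 4 sub(1) by (intro vec.span_minimal) auto
  then have "plane \<alpha> \<beta> \<gamma> \<delta> = \<omega>"
    using vec.subspace_dim_equal[OF _ sub(1), of "plane \<alpha> \<beta> \<gamma> \<delta>"] dim_plane dim
    unfolding normal_plane_def by (simp add: vec.subspace_span)
  then show ?thesis using that by blast
qed

text \<open>Modulo the plane, with \<open>e1, e2\<close> as basis of the quotient, \<open>g1\<close>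
  is \<open>(p, q)\<close> and \<open>g2\<close> is the pair of the two brackets in the equation,
  that with \<open>k1\<close> first. As \<open>e0\<close> is always common and \<open>(p, q)\<close>
  is nonzero, the intersection is a line exactly when these pairs are parallel.\<close>

lemma osculating_meets_plane:
  assumes pq: "(p, q) \<noteq> (0, 0)"
    and g1: "g1 = p *s e1 + q *s e2"
    and g2: "g2 = k0 *s e0 + k1 *s e1 + k2 *s e2 + p ^ 2 *s e3 + q ^ 2 *s e4"
  shows "vec.dim (vec.span {e0, g1, g2} \<inter> plane \<alpha> \<beta> \<gamma> \<delta>) = 2 \<longleftrightarrow>
    p * (k2 - \<beta> * p ^ 2 - \<delta> * q ^ 2) = q * (k1 - \<alpha> * p ^ 2 - \<gamma> * q ^ 2)" (is "vec.dim ?I = 2 \<longleftrightarrow> ?E")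
proof -
  have osc: "x \<in> vec.span {e0, g1, g2} \<longleftrightarrow>
    (\<exists>k l m. x = (k + m * k0) *s e0 + (l * p + m * k1) *s e1 + (l * q + m * k2) *s e2
       + (m * p ^ 2) *s e3 + (m * q ^ 2) *s e4)" for x
    unfolding mem_span3 g1 g2 by (simp add: vec_eq_iff algebra_simps)
  \<comment> \<open>Comparing the coordinates at \<open>e3\<close> and \<open>e4\<close> shows that
    every common vector combines \<open>e0\<close> with one fixed vector.\<close>
  have inter: "\<exists>k l m. x = k *s e0 + m *s (p ^ 2 *s (\<alpha> *s e1 + \<beta> *s e2 + e3)
        + q ^ 2 *s (\<gamma> *s e1 + \<delta> *s e2 + e4)) \<and>
      l * p + m * k1 = m * (p ^ 2 * \<alpha> + q ^ 2 * \<gamma>) \<and> l * q + m * k2 = m * (p ^ 2 * \<beta> + q ^ 2 * \<delta>)"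
    if x: "x \<in> ?I" for x
  proof -
    obtain k l m where 1: "x = (k + m * k0) *s e0 + (l * p + m * k1) *s e1 + (l * q + m * k2) *s e2
       + (m * p ^ 2) *s e3 + (m * q ^ 2) *s e4" using x osc by blast
    obtain k' a b where 2: "x = k' *s e0 + (a * \<alpha> + b * \<gamma>) *s e1 + (a * \<beta> + b * \<delta>) *s e2 + a *s e3
      + b *s e4"
      using x mem_plane by blast
    from coords_eq[OF 1[unfolded 2, symmetric]]
    have eqs: "l * p + m * k1 = a * \<alpha> + b * \<gamma>" "l * q + m * k2 = a * \<beta> + b * \<delta>" "a = m * p ^ 2"
      "b = m * q ^ 2"
      by simp_all
    show ?thesis
    proof (intro exI conjI)
      show "x = k' *s e0 + m *s (p ^ 2 *s (\<alpha> *s e1 + \<beta> *s e2 + e3)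
        + q ^ 2 *s (\<gamma> *s e1 + \<delta> *s e2 + e4))"
        unfolding 2 eqs(3,4) by (simp add: vec_eq_iff algebra_simps)
      show "l * p + m * k1 = m * (p ^ 2 * \<alpha> + q ^ 2 * \<gamma>)"
        "l * q + m * k2 = m * (p ^ 2 * \<beta> + q ^ 2 * \<delta>)"
        using eqs by (simp_all add: algebra_simps)
    qed
  qed
  show ?thesis
  proof
    assume "vec.dim ?I = 2"
    have "\<not> ?I \<subseteq> vec.span {e0}"
      using vec.dim_subset[of ?I "vec.span {e0}"] vec.dim_le_card'[of "{e0}"] \<open>vec.dim ?I = 2\<close>
        by auto
    then obtain x where x: "x \<in> ?I" "x \<notin> vec.span {e0}" by blast
    obtain k l m where m: "x = k *s e0 + m *s (p ^ 2 *s (\<alpha> *s e1 + \<beta> *s e2 + e3)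
      + q ^ 2 *s (\<gamma> *s e1 + \<delta> *s e2 + e4))"
      "l * p + m * k1 = m * (p ^ 2 * \<alpha> + q ^ 2 * \<gamma>)" "l * q + m * k2 = m * (p ^ 2 * \<beta> + q ^ 2 * \<delta>)"
      using inter[OF x(1)] by blast
    \<comment> \<open>A common vector off the point \<open>e0\<close> needs \<open>m\<close>
      nonzero, so \<open>m\<close> can be cancelled after eliminating \<open>l\<close>.\<close>
    have "m \<noteq> 0" using x(2) m(1) by (auto simp: mem_span1)
    moreover have "m * (p * (k2 - \<beta> * p ^ 2 - \<delta> * q ^ 2)) = m * (q * (k1 - \<alpha> * p ^ 2 - \<gamma> * q ^ 2))"
      using m(2,3) by algebra
    ultimately show ?E by simp
  next
    assume E: ?E
    \<comment> \<open>A pair parallel to the nonzero pair \<open>(p, q)\<close> is a multiple of it;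
      the case split finds a coordinate to divide by.\<close>
    have "\<exists>l. l * p = \<alpha> * p ^ 2 + \<gamma> * q ^ 2 - k1 \<and> l * q = \<beta> * p ^ 2 + \<delta> * q ^ 2 - k2"
    proof (cases "p = 0")
      case True
      then have "q \<noteq> 0" using pq by simp
      moreover then have "\<alpha> * p ^ 2 + \<gamma> * q ^ 2 - k1 = 0" using E True by simp
      ultimately show ?thesis using True
        by (intro exI[of _ "(\<beta> * p ^ 2 + \<delta> * q ^ 2 - k2) / q"]) simp
    next
      case False
      then show ?thesis using E
        by (intro exI[of _ "(\<alpha> * p ^ 2 + \<gamma> * q ^ 2 - k1) / p"]) (simp add: field_simps)
    qed
    then obtain l where l: "l * p = \<alpha> * p ^ 2 + \<gamma> * q ^ 2 - k1"
      "l * q = \<beta> * p ^ 2 + \<delta> * q ^ 2 - k2" by blast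
    let ?z = "p ^ 2 *s (\<alpha> *s e1 + \<beta> *s e2 + e3) + q ^ 2 *s (\<gamma> *s e1 + \<delta> *s e2 + e4)"
    have "?z = (- k0 + 1 * k0) *s e0 + (l * p + 1 * k1) *s e1 + (l * q + 1 * k2) *s e2
       + (1 * p ^ 2) *s e3 + (1 * q ^ 2) *s e4" unfolding l by (simp add: vec_eq_iff algebra_simps)
    then have z1: "?z \<in> vec.span {e0, g1, g2}" unfolding osc by blast
    have z2: "?z \<in> plane \<alpha> \<beta> \<gamma> \<delta>" unfolding normal_plane_def
      by (intro vec.span_add vec.span_scale vec.span_base) auto
    have e0: "e0 \<in> vec.span {e0, g1, g2}" "e0 \<in> plane \<alpha> \<beta> \<gamma> \<delta>"
      unfolding normal_plane_def by (auto intro: vec.span_base)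
    have "?I = vec.span {?z, e0}"
    proof
      show "vec.span {?z, e0} \<subseteq> ?I"
        using z1 z2 e0 by (intro vec.span_minimal vec.subspace_inter)
          (auto simp: normal_plane_def vec.subspace_span)
      show "?I \<subseteq> vec.span {?z, e0}"
        using inter unfolding mem_span2 subset_iff by (metis add.commute)
    qed
    moreover have "?z \<notin> vec.span {e0}"
    proof
      assume "?z \<in> vec.span {e0}"
      then obtain k where "?z = k *s e0" unfolding mem_span1 by blast
      then have "(-k) *s e0 + (p ^ 2 * \<alpha> + q ^ 2 * \<gamma>) *s e1 + (p ^ 2 * \<beta> + q ^ 2 * \<delta>) *s e2
        + p ^ 2 *s e3 + q ^ 2 *s e4 = 0"
        by (simp add: vec_eq_iff algebra_simps)
      from coords_zero[OF this] pq show False by simp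
    qed
    ultimately show "vec.dim ?I = 2" using e0_nonzero by (simp add: vec.dim_insert)
  qed
qed

end


section \<open>Surfaces with a conjugate net\<close>

lemma pd_x_nth: "pd_x y p $ i = px (\<lambda>q. y q $ i) p"
  by (simp add: pd_x_def px_def vderiv_def)

lemma pd_u_nth: "pd_u y p $ i = pu (\<lambda>q. y q $ i) p"
  by (simp add: pd_u_def pu_def vderiv_def)

lemma vanalytic2_on_subset: "f vanalytic2_on U \<Longrightarrow> V \<subseteq> U \<Longrightarrow> f vanalytic2_on V"
  unfolding vanalytic2_on_def using analytic2_on_subset by blast

lemma vanalytic2_on_pd:
  assumes "open U" "y vanalytic2_on U"
  shows "pd_x y vanalytic2_on U" "pd_u y vanalytic2_on U"
  using assms analytic2_on_px[of U] analytic2_on_pu[of U]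
  unfolding vanalytic2_on_def by (simp_all add: pd_x_nth[abs_def] pd_u_nth[abs_def])

lemma vanalytic2_on_add:
  "f vanalytic2_on U \<Longrightarrow> g vanalytic2_on U \<Longrightarrow> (\<lambda>p. f p + g p) vanalytic2_on U"
  unfolding vanalytic2_on_def by (simp add: analytic2_on_add)

lemma vanalytic2_on_scale:
  "k analytic2_on U \<Longrightarrow> f vanalytic2_on U \<Longrightarrow> (\<lambda>p. k p *s f p) vanalytic2_on U"
  unfolding vanalytic2_on_def by (simp add: analytic2_on_mult)

lemma pd_x_pd_u_commute:
  assumes "open U" "y vanalytic2_on U" "p \<in> U"
  shows "pd_x (pd_u y) p = pd_u (pd_x y) p"
  using assms pu_px_commute[of U _ p] unfolding vec_eq_iff vanalytic2_on_def
  by (simp add: pd_x_nth pd_u_nth)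

text \<open>The first part records differentiability, which a value of the total function
  \<open>deriv\<close> does not imply and which the second derivative requires.\<close>

lemma vderiv_along:
  assumes "z vanalytic2_on U" "(\<xi> t, \<eta> t) \<in> U"
    and "(\<xi> has_field_derivative \<xi>') (at t)" "(\<eta> has_field_derivative \<eta>') (at t)"
  shows "((\<lambda>s. z (\<xi> s, \<eta> s) $ i) has_field_derivative
      (\<xi>' *s pd_x z (\<xi> t, \<eta> t) + \<eta>' *s pd_u z (\<xi> t, \<eta> t)) $ i) (at t)"
    and "vderiv (\<lambda>s. z (\<xi> s, \<eta> s)) t = \<xi>' *s pd_x z (\<xi> t, \<eta> t) + \<eta>' *s pd_u z (\<xi> t, \<eta> t)"
proof -
  show *: "((\<lambda>s. z (\<xi> s, \<eta> s) $ i) has_field_derivative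
      (\<xi>' *s pd_x z (\<xi> t, \<eta> t) + \<eta>' *s pd_u z (\<xi> t, \<eta> t)) $ i) (at t)" for i
    using analytic2_on_chain[of "\<lambda>p. z p $ i" U, OF _ assms(2-4)] assms(1)
    by (simp add: vanalytic2_on_def pd_x_nth pd_u_nth mult.commute)
  show "vderiv (\<lambda>s. z (\<xi> s, \<eta> s)) t = \<xi>' *s pd_x z (\<xi> t, \<eta> t) + \<eta>' *s pd_u z (\<xi> t, \<eta> t)"
    unfolding vec_eq_iff vderiv_def by (simp only: vec_lambda_beta DERIV_imp_deriv[OF *] simp_thms)
qed

text \<open>The chain rule applied twice; the two mixed terms coincide, whence the factor 2.\<close>

lemma vderiv2_along:
  assumes U: "open U" and y: "y vanalytic2_on U" and c: "surface_curve U T \<xi> \<eta>" and t: "t \<in> T"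
  defines "p \<equiv> (\<xi> t, \<eta> t)"
  shows "vderiv (vderiv (\<lambda>s. y (\<xi> s, \<eta> s))) t =
    deriv (deriv \<xi>) t *s pd_x y p + deriv (deriv \<eta>) t *s pd_u y p +
    (deriv \<xi> t) ^ 2 *s pd_x (pd_x y) p + (2 * deriv \<xi> t * deriv \<eta> t) *s pd_u (pd_x y) p +
    (deriv \<eta> t) ^ 2 *s pd_u (pd_u y) p" (is "_ = ?r")
proof -
  have T: "open T" and hol: "\<xi> holomorphic_on T" "\<eta> holomorphic_on T"
    and U_in: "\<And>s. s \<in> T \<Longrightarrow> (\<xi> s, \<eta> s) \<in> U"
    using c unfolding surface_curve_def by auto
  have d: "(\<xi> has_field_derivative deriv \<xi> s) (at s)" "(\<eta> has_field_derivative deriv \<eta> s) (at s)"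
    and dd: "(deriv \<xi> has_field_derivative deriv (deriv \<xi>) s) (at s)"
      "(deriv \<eta> has_field_derivative deriv (deriv \<eta>) s) (at s)" if "s \<in> T" for s
    using holomorphic_derivI[OF _ T that] hol holomorphic_deriv[OF _ T] by blast+
  have "((\<lambda>s. vderiv (\<lambda>s. y (\<xi> s, \<eta> s)) s $ i) has_field_derivative ?r $ i) (at t)" for i
  proof (rule has_field_derivative_transform_within_open[OF _ T t])
    show "((\<lambda>s. deriv \<xi> s * pd_x y (\<xi> s, \<eta> s) $ i + deriv \<eta> s * pd_u y (\<xi> s, \<eta> s) $ i)
        has_field_derivative ?r $ i) (at t)"
      using vderiv_along(1)[OF vanalytic2_on_pd(1)[OF U y] U_in[OF t] d[OF t], of i]
        vderiv_along(1)[OF vanalytic2_on_pd(2)[OF U y] U_in[OF t] d[OF t], of i]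
        pd_x_pd_u_commute[OF U y U_in[OF t]]
      by (auto intro!: derivative_eq_intros dd[OF t] simp: p_def algebra_simps power2_eq_square)
    show "deriv \<xi> s * pd_x y (\<xi> s, \<eta> s) $ i + deriv \<eta> s * pd_u y (\<xi> s, \<eta> s) $ i =
        vderiv (\<lambda>s. y (\<xi> s, \<eta> s)) s $ i" if "s \<in> T" for s
      using vderiv_along(2)[OF y U_in[OF that] d[OF that]] by simp
  qed
  then show ?thesis unfolding vec_eq_iff vderiv_def[of "vderiv _"] by (auto intro: DERIV_imp_deriv)
qed


text \<open>Membership writes \<open>z\<close> in the frame \<open>w1, w2, w3, d, e\<close> with
  coefficients \<open>- \<alpha>\<close> and \<open>- \<beta>\<close> at \<open>d\<close> and
  \<open>e\<close>. It is applied with the two first partial derivatives as \<open>d, e\<close> and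
  a pure second one as \<open>z\<close>.\<close>

lemma plane_coords_analytic:
  fixes w1 w2 w3 d e z :: "complex \<times> complex \<Rightarrow> complex ^ 'n"
  assumes V: "open V" "p \<in> V"
    and an: "w1 vanalytic2_on V" "w2 vanalytic2_on V" "w3 vanalytic2_on V" "d vanalytic2_on V"
      "e vanalytic2_on V" "z vanalytic2_on V"
    and dim: "vec.dim {w1 p, w2 p, w3 p, d p, e p} = 5"
    and mem: "\<And>q. q \<in> V \<Longrightarrow> \<alpha> q *s d q + \<beta> q *s e q + z q \<in> vec.span {w1 q, w2 q, w3 q}"
  shows "\<alpha> analytic2_on {p}" "\<beta> analytic2_on {p}"
proof -
  let ?v = "vec5 w1 w2 w3 d e"
  have "\<forall>q. \<exists>c :: complex ^ 5. q \<in> V \<longrightarrow> z q = (\<Sum>i\<in>UNIV. c $ i *s ?v i q) \<and> c $ 4 = - \<alpha> q \<and>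
    c $ 5 = - \<beta> q"
  proof
    fix q
    show "\<exists>c :: complex ^ 5. q \<in> V \<longrightarrow> z q = (\<Sum>i\<in>UNIV. c $ i *s ?v i q) \<and> c $ 4 = - \<alpha> q \<and>
      c $ 5 = - \<beta> q"
    proof (cases "q \<in> V")
      case True
      obtain k l m where klm: "\<alpha> q *s d q + \<beta> q *s e q + z q = k *s w1 q + l *s w2 q + m *s w3 q"
        using mem[OF True] unfolding mem_span3 by blast
      then have "z q = k *s w1 q + l *s w2 q + m *s w3 q + (- \<alpha> q) *s d q + (- \<beta> q) *s e q"
        by (simp add: vec_eq_iff algebra_simps)
      then show ?thesis
        by (intro exI[of _ "\<chi> i. vec5 k l m (- \<alpha> q) (- \<beta> q) i"]) (simp add: sum_5)
    qed simp
  qed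
  from choice[OF this] obtain c :: "complex \<times> complex \<Rightarrow> complex ^ 5"
    where c: "\<And>q. q \<in> V \<Longrightarrow> z q = (\<Sum>i\<in>UNIV. c q $ i *s ?v i q) \<and> c q $ 4 = - \<alpha> q \<and> c q $ 5 = - \<beta> q"
    by blast
  have p: "(\<lambda>i. ?v i p) = vec5 (w1 p) (w2 p) (w3 p) (d p) (e p)"
    by (auto simp: vec5_def)
  have an_p: "h vanalytic2_on {p}" if "h vanalytic2_on V"
    for h :: "complex \<times> complex \<Rightarrow> complex ^ 'n"
    using that V(2) vanalytic2_on_subset by blast
  have ev: "\<forall>\<^sub>F q in nhds p. q \<in> V" using V by (rule eventually_nhds_in_open)
  have c_an: "(\<lambda>q. c q $ k) analytic2_on {p}" for k
  proof (rule coefficients_analytic)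
    show "?v i vanalytic2_on {p}" for i
      using an by (simp add: vec5_def an_p)
    show "z vanalytic2_on {p}" using an by (simp add: an_p)
    show "inj (\<lambda>i. ?v i p)" "vec.independent (range (\<lambda>i. ?v i p))"
      unfolding p using dim dim_range_eq_card[of "vec5 (w1 p) (w2 p) (w3 p) (d p) (e p)"]
      by (simp_all add: range_vec5)
    show "\<forall>\<^sub>F q in nhds p. z q = (\<Sum>i\<in>UNIV. c q $ i *s ?v i q)"
      using ev by eventually_elim (use c in blast)
  qed
  show "\<alpha> analytic2_on {p}"
    by (rule analytic2_on_cong_at[OF analytic2_on_uminus[OF c_an[of 4]]])
      (use ev in eventually_elim, simp add: c)
  show "\<beta> analytic2_on {p}"
    by (rule analytic2_on_cong_at[OF analytic2_on_uminus[OF c_an[of 5]]])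
      (use ev in eventually_elim, simp add: c)
qed

section \<open>Congruences and differential equations on a fixed conjugate net\<close>

locale conjugate_net =
  fixes U :: "(complex \<times> complex) set" and y :: "complex \<times> complex \<Rightarrow> complex ^ 'n"
    and a b c :: "complex \<times> complex \<Rightarrow> complex"
  assumes U: "open U" and y: "y vanalytic2_on U"
    and a: "a analytic2_on U" and b: "b analytic2_on U"
    and laplace: "p \<in> U \<Longrightarrow> pd_u (pd_x y) p + a p *s pd_x y p + b p *s pd_u y p + c p *s y p = 0"
    and S20_dim: "p \<in> U \<Longrightarrow> proj_subspace 4 (S20 y p)"
begin

abbreviation "N p \<equiv> normal_plane (y p) (pd_x y p) (pd_u y p) (pd_x (pd_x y) p) (pd_u (pd_u y) p)"

lemma mixed_partial_eq: "p \<in> U \<Longrightarrow>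
  pd_u (pd_x y) p = (- c p) *s y p + (- a p) *s pd_x y p + (- b p) *s pd_u y p"
  using laplace by (simp add: vec_eq_iff eq_neg_iff_add_eq_0 algebra_simps)

lemma S20_eq:
  assumes "p \<in> U"
  shows "S20 y p = vec.span {y p, pd_x y p, pd_u y p, pd_x (pd_x y) p, pd_u (pd_u y) p}"
    (is "_ = vec.span ?B")
proof -
  have "pd_u (pd_x y) p \<in> vec.span {y p, pd_x y p, pd_u y p}"
    unfolding mem_span3 using mixed_partial_eq[OF assms] by blast
  then have "pd_u (pd_x y) p \<in> vec.span ?B"
    using vec.span_mono[of "{y p, pd_x y p, pd_u y p}" ?B] by blast
  then have "vec.span (insert (pd_u (pd_x y) p) ?B) = vec.span ?B" by (rule vec.span_redundant)
  then show ?thesis unfolding S20_def by (simp add: insert_commute)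
qed

lemma frame:
  assumes "p \<in> U"
  shows "frame (y p) (pd_x y p) (pd_u y p) (pd_x (pd_x y) p) (pd_u (pd_u y) p)"
  using S20_dim[OF assms] unfolding S20_eq[OF assms] by unfold_locales (simp add: proj_subspace_def)

lemma plane_system_normal:
  assumes \<omega>: "\<And>p. p \<in> U \<Longrightarrow> \<omega> p = N p (\<alpha> p) (\<beta> p) (\<gamma> p) (\<delta> p)"
  shows "plane_system U y \<omega> =
    integral_curves U \<beta> (\<lambda>p. 2 * b p - \<alpha> p) (\<lambda>p. \<delta> p - 2 * a p) (\<lambda>p. - \<gamma> p)"
proof -
  have "proj_subspace 1 (osculating_plane (\<lambda>s. y (\<xi> s, \<eta> s)) t \<inter> \<omega> (\<xi> t, \<eta> t)) \<longleftrightarrow>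
      deriv \<xi> t * deriv (deriv \<eta>) t - deriv \<eta> t * deriv (deriv \<xi>) t =
        \<beta> (\<xi> t, \<eta> t) * deriv \<xi> t ^ 3
          + (2 * b (\<xi> t, \<eta> t) - \<alpha> (\<xi> t, \<eta> t)) * deriv \<xi> t ^ 2 * deriv \<eta> t +
        (\<delta> (\<xi> t, \<eta> t) - 2 * a (\<xi> t, \<eta> t)) * deriv \<xi> t * deriv \<eta> t ^ 2
          + - \<gamma> (\<xi> t, \<eta> t) * deriv \<eta> t ^ 3"
    (is "?L \<longleftrightarrow> ?R")
    if curve: "surface_curve U T \<xi> \<eta>" and t: "t \<in> T" for T \<xi> \<eta> t
  proof -
    define p where "p = (\<xi> t, \<eta> t)"
    define x' u' x'' u'' where "x' = deriv \<xi> t" and "u' = deriv \<eta> t"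
      and "x'' = deriv (deriv \<xi>) t" and "u'' = deriv (deriv \<eta>) t"
    let ?g = "\<lambda>s. y (\<xi> s, \<eta> s)"
    have T: "open T" "\<xi> holomorphic_on T" "\<eta> holomorphic_on T" and p: "p \<in> U"
      and ne: "(x', u') \<noteq> (0, 0)"
      using curve t unfolding surface_curve_def p_def x'_def u'_def by auto
    interpret frame "y p" "pd_x y p" "pd_u y p" "pd_x (pd_x y) p" "pd_u (pd_u y) p"
      by (rule frame[OF p])
    have g1: "vderiv ?g t = x' *s pd_x y p + u' *s pd_u y p"
      unfolding p_def x'_def u'_def
      by (rule vderiv_along(2)[OF y]) (use p T t in \<open>auto simp: p_def intro: holomorphic_derivI\<close>)
    have g2: "vderiv (vderiv ?g) t = (- 2 * x' * u' * c p) *s y p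
      + (x'' - 2 * a p * x' * u') *s pd_x y p +
        (u'' - 2 * b p * x' * u') *s pd_u y p + x' ^ 2 *s pd_x (pd_x y) p
          + u' ^ 2 *s pd_u (pd_u y) p"
      unfolding vderiv2_along[OF U y curve t, folded p_def x'_def u'_def x''_def u''_def]
        mixed_partial_eq[OF p]
      by (simp add: vec_eq_iff algebra_simps)
    have "?L \<longleftrightarrow>
      vec.dim (vec.span {y p, vderiv ?g t, vderiv (vderiv ?g) t} \<inter>
        plane (\<alpha> p) (\<beta> p) (\<gamma> p) (\<delta> p)) = 2"
      using \<omega>[OF p] unfolding proj_subspace_def osculating_plane_def p_def[symmetric]
      by (simp add: vec.subspace_inter vec.subspace_span normal_plane_def numeral_2_eq_2)
    also have "\<dots> \<longleftrightarrow> x' * ((u'' - 2 * b p * x' * u') - \<beta> p * x' ^ 2 - \<delta> p * u' ^ 2) =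
        u' * ((x'' - 2 * a p * x' * u') - \<alpha> p * x' ^ 2 - \<gamma> p * u' ^ 2)"
      by (rule osculating_meets_plane[OF ne g1 g2])
    also have "\<dots> \<longleftrightarrow> x' * u'' - u' * x'' = \<beta> p * x' ^ 3 + (2 * b p - \<alpha> p) * x' ^ 2 * u' +
        (\<delta> p - 2 * a p) * x' * u' ^ 2 + - \<gamma> p * u' ^ 3"
      by algebra
    finally show ?thesis unfolding p_def x'_def u'_def x''_def u''_def .
  qed
  then show ?thesis unfolding plane_system_def integral_curves_def by blast
qed

text \<open>The parameters are first chosen point by point; their analyticity follows afterwards
  from that of the local spanning vectors.\<close>

lemma congruence_normal:
  assumes \<omega>: "plane_congruence U y \<omega>"
  obtains \<alpha> \<beta> \<gamma> \<delta> where "\<alpha> analytic2_on U" "\<beta> analytic2_on U" "\<gamma> analytic2_on U" "\<delta> analytic2_on U"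
    "\<And>p. p \<in> U \<Longrightarrow> \<omega> p = N p (\<alpha> p) (\<beta> p) (\<gamma> p) (\<delta> p)"
proof -
  have "\<exists>k1 k2 k3 k4. \<omega> p = N p k1 k2 k3 k4" if p: "p \<in> U" for p
  proof -
    interpret frame "y p" "pd_x y p" "pd_u y p" "pd_x (pd_x y) p" "pd_u (pd_u y) p"
      by (rule frame[OF p])
    have "vec.subspace (\<omega> p)" "vec.dim (\<omega> p) = 3" "\<omega> p \<subseteq> S20 y p"
      "\<omega> p \<inter> tangent_plane y p = vec.span {y p}"
      using \<omega> p unfolding plane_congruence_def proj_subspace_def by auto
    then show ?thesis using normal_form[of "\<omega> p"] unfolding S20_eq[OF p] tangent_plane_def by metis
  qed
  then obtain \<alpha> \<beta> \<gamma> \<delta> where N: "\<And>p. p \<in> U \<Longrightarrow> \<omega> p = N p (\<alpha> p) (\<beta> p) (\<gamma> p) (\<delta> p)"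
    by metis
  have "\<alpha> analytic2_on {p} \<and> \<beta> analytic2_on {p} \<and> \<gamma> analytic2_on {p} \<and> \<delta> analytic2_on {p}"
    if p: "p \<in> U" for p
  proof -
    obtain V w1 w2 w3 where V: "open V" "p \<in> V" "V \<subseteq> U"
      and w: "w1 vanalytic2_on V" "w2 vanalytic2_on V" "w3 vanalytic2_on V"
      and span: "\<And>q. q \<in> V \<Longrightarrow> \<omega> q = vec.span {w1 q, w2 q, w3 q}"
      using \<omega> p unfolding plane_congruence_def by meson
    have mem: "\<alpha> q *s pd_x y q + \<beta> q *s pd_u y q + pd_x (pd_x y) q \<in> vec.span {w1 q, w2 q, w3 q}"
      "\<gamma> q *s pd_x y q + \<delta> q *s pd_u y q + pd_u (pd_u y) q \<in> vec.span {w1 q, w2 q, w3 q}"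
      "y q \<in> vec.span {w1 q, w2 q, w3 q}" if "q \<in> V" for q
      using N[of q] span[OF that] that V(3) unfolding normal_plane_def by (auto simp: vec.span_base)
    \<comment> \<open>The plane contains \<open>y\<close> and the pure second derivatives up to
      tangent corrections; with \<open>pd_x y\<close> and \<open>pd_u y\<close> adjoined, the
      corrections can be subtracted and the whole frame is reached.\<close>
    have dim: "vec.dim {w1 p, w2 p, w3 p, pd_x y p, pd_u y p} = 5" (is "vec.dim ?W = 5")
    proof (rule antisym)
      have "vec.dim ?W \<le> card ?W" by (rule vec.dim_le_card') simp
      also have "\<dots> \<le> 5" by (simp add: card_insert_if)
      finally show "vec.dim ?W \<le> 5" .
      have sub: "vec.span {w1 p, w2 p, w3 p} \<subseteq> vec.span ?W" by (rule vec.span_mono) auto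
      have e12: "pd_x y p \<in> vec.span ?W" "pd_u y p \<in> vec.span ?W" by (auto intro: vec.span_base)
      have e34: "e \<in> vec.span ?W"
        if "k *s pd_x y p + l *s pd_u y p + e \<in> vec.span {w1 p, w2 p, w3 p}" for k l e
        using vec.span_diff[OF subsetD[OF sub that]
          vec.span_add[OF vec.span_scale[OF e12(1), of k] vec.span_scale[OF e12(2), of l]]]
        by simp
      have "{y p, pd_x y p, pd_u y p, pd_x (pd_x y) p, pd_u (pd_u y) p} \<subseteq> vec.span ?W"
        using mem[OF V(2)] sub e12 e34 by blast
      then have "vec.dim {y p, pd_x y p, pd_u y p, pd_x (pd_x y) p, pd_u (pd_u y) p} \<le> vec.dim ?W"
        by (rule vec.dim_mono)
      then show "5 \<le> vec.dim ?W" using frame.dim_frame[OF frame[OF p]] by simp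
    qed
    note pd = vanalytic2_on_pd[OF U] and res = vanalytic2_on_subset[OF _ V(3)]
    show ?thesis
      using plane_coords_analytic[OF V(1,2) w res[OF pd(1)[OF y]] res[OF pd(2)[OF y]]
          res[OF pd(1)[OF pd(1)[OF y]]] dim mem(1)]
        plane_coords_analytic[OF V(1,2) w res[OF pd(1)[OF y]] res[OF pd(2)[OF y]]
          res[OF pd(2)[OF pd(2)[OF y]]] dim mem(2)]
      by blast
  qed
  then have "\<alpha> analytic2_on U" "\<beta> analytic2_on U" "\<gamma> analytic2_on U" "\<delta> analytic2_on U"
    unfolding analytic2_on_pointwise[of _ U] by blast+
  then show ?thesis using N by (rule that)
qed

lemma normal_congruence:
  assumes "\<alpha> analytic2_on U" "\<beta> analytic2_on U" "\<gamma> analytic2_on U" "\<delta> analytic2_on U"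
  shows "plane_congruence U y (\<lambda>p. N p (\<alpha> p) (\<beta> p) (\<gamma> p) (\<delta> p))"
  unfolding plane_congruence_def
proof (intro conjI ballI)
  fix p assume p: "p \<in> U"
  interpret frame "y p" "pd_x y p" "pd_u y p" "pd_x (pd_x y) p" "pd_u (pd_u y) p"
    by (rule frame[OF p])
  show "proj_subspace 2 (N p (\<alpha> p) (\<beta> p) (\<gamma> p) (\<delta> p))"
    using dim_plane unfolding proj_subspace_def by (simp add: normal_plane_def vec.subspace_span)
  show "N p (\<alpha> p) (\<beta> p) (\<gamma> p) (\<delta> p) \<subseteq> S20 y p" unfolding S20_eq[OF p] by (rule plane_subset)
  show "y p \<in> N p (\<alpha> p) (\<beta> p) (\<gamma> p) (\<delta> p)" by (simp add: normal_plane_def vec.span_base)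
  show "N p (\<alpha> p) (\<beta> p) (\<gamma> p) (\<delta> p) \<inter> tangent_plane y p = vec.span {y p}"
    unfolding tangent_plane_def by (rule plane_meets_tangent)
  show "\<exists>V w1 w2 w3. open V \<and> p \<in> V \<and> V \<subseteq> U \<and>
      w1 vanalytic2_on V \<and> w2 vanalytic2_on V \<and> w3 vanalytic2_on V \<and>
      (\<forall>q\<in>V. N q (\<alpha> q) (\<beta> q) (\<gamma> q) (\<delta> q) = vec.span {w1 q, w2 q, w3 q})"
    using U p assms unfolding normal_plane_def
    by (intro exI[of _ U] exI[of _ y]
        exI[of _ "\<lambda>q. \<alpha> q *s pd_x y q + \<beta> q *s pd_u y q + pd_x (pd_x y) q"]
        exI[of _ "\<lambda>q. \<gamma> q *s pd_x y q + \<delta> q *s pd_u y q + pd_u (pd_u y) q"] conjI)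
      (auto intro!: vanalytic2_on_add vanalytic2_on_scale vanalytic2_on_pd y)
qed

text \<open>The last clause recovers the planes from the coefficients; it makes the congruence
  unique once the coefficients are.\<close>

lemma congruence_equation:
  assumes "plane_congruence U y \<omega>"
  obtains A B C D where "analytic_coeffs U A B C D" "plane_system U y \<omega> = integral_curves U A B C D"
    "\<forall>p\<in>U. \<omega> p = N p (2 * b p - B p) (A p) (- D p) (C p + 2 * a p)"
proof -
  obtain \<alpha> \<beta> \<gamma> \<delta>
    where an: "\<alpha> analytic2_on U" "\<beta> analytic2_on U" "\<gamma> analytic2_on U" "\<delta> analytic2_on U"
    and N: "\<And>p. p \<in> U \<Longrightarrow> \<omega> p = N p (\<alpha> p) (\<beta> p) (\<gamma> p) (\<delta> p)"
    using congruence_normal[OF assms] by blast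
  show ?thesis
    by (rule that[OF _ plane_system_normal[OF N]])
      (auto simp: analytic_coeffs_def N intro!: analytic2_intros an a b)
qed

text \<open>The plane parameters are found by solving the relations of
  \<open>plane_system_normal\<close> for them.\<close>

lemma equation_congruence:
  assumes "analytic_coeffs U A B C D"
  defines "\<omega> \<equiv> \<lambda>p. N p (2 * b p - B p) (A p) (- D p) (C p + 2 * a p)"
  shows "plane_congruence U y \<omega>" "plane_system U y \<omega> = integral_curves U A B C D"
proof -
  show "plane_congruence U y \<omega>"
    unfolding \<omega>_def using assms(1)
    by (intro normal_congruence) (auto simp: analytic_coeffs_def intro!: analytic2_intros a b)
  have "plane_system U y \<omega> = integral_curves U A (\<lambda>p. 2 * b p - (2 * b p - B p))
      (\<lambda>p. C p + 2 * a p - 2 * a p) (\<lambda>p. - (- D p))"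
    by (rule plane_system_normal) (simp add: \<omega>_def)
  then show "plane_system U y \<omega> = integral_curves U A B C D" by simp
qed

end

theorem theorem2p10:
  fixes U :: "(complex \<times> complex) set"
    and y :: "complex \<times> complex \<Rightarrow> complex ^ 'n"
  assumes "conjugate_net_surface U y"
  shows
    "(\<forall>\<omega>. plane_congruence U y \<omega> \<longrightarrow>
       (\<exists>A B C D. analytic_coeffs U A B C D \<and>
          plane_system U y \<omega> = integral_curves U A B C D \<and>
          (\<forall>A' B' C' D'. analytic_coeffs U A' B' C' D' \<and>
             plane_system U y \<omega> = integral_curves U A' B' C' D' \<longrightarrow>
             (\<forall>p\<in>U. A' p = A p \<and> B' p = B p \<and> C' p = C p \<and> D' p = D p)))) \<and>
     (\<forall>A B C D. analytic_coeffs U A B C D \<longrightarrow>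
       (\<exists>\<omega>. plane_congruence U y \<omega> \<and>
          plane_system U y \<omega> = integral_curves U A B C D \<and>
          (\<forall>\<omega>'. plane_congruence U y \<omega>' \<and>
             plane_system U y \<omega>' = integral_curves U A B C D \<longrightarrow>
             (\<forall>p\<in>U. \<omega>' p = \<omega> p)))) \<and>
     (\<forall>A B C D T f. analytic_coeffs U A B C D \<and> surface_curve U T (\<lambda>x. x) f \<longrightarrow>
       ((T, (\<lambda>x. x), f) \<in> integral_curves U A B C D \<longleftrightarrow>
        (\<forall>x\<in>T. deriv (deriv f) x =
           A (x, f x) + B (x, f x) * deriv f x + C (x, f x) * deriv f x ^ 2 +
           D (x, f x) * deriv f x ^ 3)))"
proof -
  obtain a b c where "conjugate_net U y a b c"
    using assms unfolding conjugate_net_surface_def conjugate_net_def by blast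
  then interpret conjugate_net U y a b c .
  show ?thesis
  proof (intro conjI allI impI)
    fix \<omega> assume "plane_congruence U y \<omega>"
    then obtain A B C D where *: "analytic_coeffs U A B C D"
      "plane_system U y \<omega> = integral_curves U A B C D"
      by (rule congruence_equation)
    show "\<exists>A B C D. analytic_coeffs U A B C D \<and>
          plane_system U y \<omega> = integral_curves U A B C D \<and>
          (\<forall>A' B' C' D'. analytic_coeffs U A' B' C' D' \<and>
             plane_system U y \<omega> = integral_curves U A' B' C' D' \<longrightarrow>
             (\<forall>p\<in>U. A' p = A p \<and> B' p = B p \<and> C' p = C p \<and> D' p = D p))"
    proof (intro exI conjI allI impI ballI)
      show "analytic_coeffs U A B C D" "plane_system U y \<omega> = integral_curves U A B C D" by (fact *)+
      fix A' B' C' D' p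
      assume "analytic_coeffs U A' B' C' D' \<and> plane_system U y \<omega> = integral_curves U A' B' C' D'"
        and p: "p \<in> U"
      then show "A' p = A p" "B' p = B p" "C' p = C p" "D' p = D p"
        using integral_curves_determine_coeffs[OF U *(1) _ p, of A' B' C' D'] *(2) by auto
    qed
  next
    fix A B C D assume co: "analytic_coeffs U A B C D"
    note \<omega> = equation_congruence[OF co]
    show "\<exists>\<omega>. plane_congruence U y \<omega> \<and> plane_system U y \<omega> = integral_curves U A B C D \<and>
          (\<forall>\<omega>'. plane_congruence U y \<omega>' \<and> plane_system U y \<omega>' = integral_curves U A B C D \<longrightarrow>
             (\<forall>p\<in>U. \<omega>' p = \<omega> p))"
    proof (intro exI conjI allI impI ballI)
      show "plane_congruence U y (\<lambda>p. N p (2 * b p - B p) (A p) (- D p) (C p + 2 * a p))"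
        "plane_system U y (\<lambda>p. N p (2 * b p - B p) (A p) (- D p) (C p + 2 * a p)) =
          integral_curves U A B C D"
        by (fact \<omega>)+
      fix \<omega>' p assume \<omega>': "plane_congruence U y \<omega>' \<and>
        plane_system U y \<omega>' = integral_curves U A B C D"
        and p: "p \<in> U"
      \<comment> \<open>The competing congruence has coefficients of its own; these must be the
        given ones, and they recover its planes.\<close>
      from \<omega>' have "plane_congruence U y \<omega>'" ..
      then obtain A' B' C' D' where "analytic_coeffs U A' B' C' D'"
        "plane_system U y \<omega>' = integral_curves U A' B' C' D'"
        "\<forall>p\<in>U. \<omega>' p = N p (2 * b p - B' p) (A' p) (- D' p) (C' p + 2 * a p)"
        by (rule congruence_equation)
      then show "\<omega>' p = N p (2 * b p - B p) (A p) (- D p) (C p + 2 * a p)"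
        using integral_curves_determine_coeffs[OF U co _ p, of A' B' C' D'] \<omega>' p by auto
    qed
  next
    \<comment> \<open>With \<open>x\<close> as parameter its first derivative is 1 and its second 0,
      which reduces the homogeneous equation to the inhomogeneous form.\<close>
    fix A B C D T f assume *: "analytic_coeffs U A B C D \<and> surface_curve U T (\<lambda>x. x) f"
    then show "(T, (\<lambda>x. x), f) \<in> integral_curves U A B C D \<longleftrightarrow>
        (\<forall>x\<in>T. deriv (deriv f) x =
           A (x, f x) + B (x, f x) * deriv f x + C (x, f x) * deriv f x ^ 2 +
           D (x, f x) * deriv f x ^ 3)"
      by (simp add: integral_curves_def)
  qed
qed

end
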